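(* Let $N\ge1$, $T>0$, and let $c,\psi$ satisfy the standing assumptions in the context. There exists a Nash equilibrium, i.e. an admissible control $\beta_*:\{0,1\}\times\{0,\dots,N\}\times[0,T]\to[0,\infty)$ with $\bar\alpha(\beta_* )=\beta_*$. Moreover, the Nash equilibrium is unique.
   Context: Standing assumptions on costs. $c:\{0,1\}\times[0,1]\times[0,\infty)\to\mathbb{R}$, $(i,\theta,\alpha)\mapsto c(i,\theta,\alpha)$, and $\psi:\{0,1\}\times[0,1]\to\mathbb{R}$ are non-negative and Lipschitz in $\theta$ (for each fixed value of the other variables). $c$ is differentiable in $\alpha$, with derivative $c'(i,\theta,\alpha)$ (one-sided at $\alpha=0$), and $c'$ is Lipschitz in $\theta$ with a constant independent of $(i,\alpha)$. $c$ is uniformly convex in $\alpha$: there is $\kappa>0$ with $c(i,\theta,\alpha')\ge c(i,\theta,\alpha)+c'(i,\theta,\alpha)(\alpha'-\alpha)+\kappa|\alpha'-\alpha|^2$ for all $i,\theta$ and $\alpha,\alpha'\ge0$; and $c$ is superlinear in $\alpha$ (i.e. $c(i,\theta,\alpha)/\alpha\to\infty$ as $\alpha\to\infty$). For $p\in\mathbb{R}$ put $h(p,\theta,i)=\min_{\alpha\ge0}[c(i,\theta,\alpha)+\alpha p]$ and let $\alpha^*(p,\theta,i)$ be the unique minimizer. An admissible control is a function $\beta:\{0,1\}\times\{0,\dots,N\}\times[0,T]\to[0,\infty)$, $(i,n,t)\mapsto\beta(i,n,t)$, bounded and continuous in $t$. For an admissible control $\beta$ set $$\gamma^+_\beta(i,n,t)=(N-n)\,\beta(1,n+1-i,t),\qquad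 \gamma^-_\beta(i,n,t)=n\,\beta(0,n-i,t)$$ (terms with zero prefactor are $0$). Let $\varphi_\beta:\{0,1\}\times\{0,\dots,N\}\times[0,T]\to\mathbb{R}$ be the solution of $$-\frac{d\varphi}{dt}(i,n,t)=\gamma^+_\beta(i,n,t)(\varphi(i,n+1,t)-\varphi(i,n,t))+\gamma^-_\beta(i,n,t)(\varphi(i,n-1,t)-\varphi(i,n,t))+h\Big(\varphi(1-i,n,t)-\varphi(i,n,t),\tfrac nN,i\Big)$$ with $\varphi_\beta(i,n,T)=\psi(i,\frac nN)$. The best response to $\beta$ is the control $$\bar\alpha(\beta)(i,n,t)=\alpha^*\Big(\varphi_\beta(1-i,n,t)-\varphi_\beta(i,n,t),\tfrac nN,i\Big).$$ An admissible control $\beta$ is called a Nash equilibrium if $\bar\alpha(\beta)=\beta$. *)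

theory Defs
  imports "HOL-Analysis.Analysis"
begin

text \<open>States are encoded as the naturals 0 and 1. The functions \<open>c\<close>, \<open>c'\<close> and \<open>\<psi>\<close> are total in
  the logic, but they are constrained, and below only evaluated, on \<open>{0,1} \<times> [0,1] \<times> [0,\<infinity>)\<close> and
  \<open>{0,1} \<times> [0,1]\<close> respectively.\<close>

locale cost_assumptions =
  fixes c c' :: "nat \<Rightarrow> real \<Rightarrow> real \<Rightarrow> real" and \<psi> :: "nat \<Rightarrow> real \<Rightarrow> real"
  assumes c_nonneg: "\<forall>i\<in>{0, 1}. \<forall>\<theta>\<in>{0..1}. \<forall>\<alpha>\<ge>0. 0 \<le> c i \<theta> \<alpha>"
    and psi_nonneg: "\<forall>i\<in>{0, 1}. \<forall>\<theta>\<in>{0..1}. 0 \<le> \<psi> i \<theta>"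
    and c_lipschitz: "\<forall>i\<in>{0, 1}. \<forall>\<alpha>\<ge>0. \<exists>L. L-lipschitz_on {0..1} (\<lambda>\<theta>. c i \<theta> \<alpha>)"
    and psi_lipschitz: "\<forall>i\<in>{0, 1}. \<exists>L. L-lipschitz_on {0..1} (\<psi> i)"
    and c_deriv: "\<forall>i\<in>{0, 1}. \<forall>\<theta>\<in>{0..1}. \<forall>\<alpha>\<ge>0.
      (c i \<theta> has_real_derivative c' i \<theta> \<alpha>) (at \<alpha> within {0..})"
    and c'_lipschitz: "\<exists>L. \<forall>i\<in>{0, 1}. \<forall>\<alpha>\<ge>0. L-lipschitz_on {0..1} (\<lambda>\<theta>. c' i \<theta> \<alpha>)"
    and c_uniformly_convex: "\<exists>\<kappa>>0. \<forall>i\<in>{0, 1}. \<forall>\<theta>\<in>{0..1}. \<forall>\<alpha>\<ge>0. \<forall>\<alpha>'\<ge>0.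
      c i \<theta> \<alpha>' \<ge> c i \<theta> \<alpha> + c' i \<theta> \<alpha> * (\<alpha>' - \<alpha>) + \<kappa> * \<bar>\<alpha>' - \<alpha>\<bar>\<^sup>2"
    and c_superlinear: "\<forall>i\<in>{0, 1}. \<forall>\<theta>\<in>{0..1}.
      filterlim (\<lambda>\<alpha>. c i \<theta> \<alpha> / \<alpha>) at_top at_top"

text \<open>\<open>LEAST\<close> on the reals is the minimum of the set of attained values.\<close>

definition hamiltonian ::
  "(nat \<Rightarrow> real \<Rightarrow> real \<Rightarrow> real) \<Rightarrow> real \<Rightarrow> real \<Rightarrow> nat \<Rightarrow> real" where
  "hamiltonian c p \<theta> i = (LEAST y. \<exists>\<alpha>\<ge>0. y = c i \<theta> \<alpha> + \<alpha> * p)"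

definition opt_rate ::
  "(nat \<Rightarrow> real \<Rightarrow> real \<Rightarrow> real) \<Rightarrow> real \<Rightarrow> real \<Rightarrow> nat \<Rightarrow> real" where
  "opt_rate c p \<theta> i = (THE \<alpha>. is_arg_min (\<lambda>a. c i \<theta> a + a * p) (\<lambda>a. 0 \<le> a) \<alpha>)"

text \<open>Controls and value functions are uncurried and extensional on the state-time domain, so that
  equality in the logic is equality of functions on that domain.\<close>

definition state_time :: "nat \<Rightarrow> real \<Rightarrow> (nat \<times> nat \<times> real) set" where
  "state_time N T = {0, 1} \<times> {0..N} \<times> {0..T}"

definition admissible :: "nat \<Rightarrow> real \<Rightarrow> (nat \<times> nat \<times> real \<Rightarrow> real) \<Rightarrow> bool" where
  "admissible N T \<beta> \<longleftrightarrow>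
     \<beta> \<in> state_time N T \<rightarrow>\<^sub>E {0..} \<and>
     bounded (\<beta> ` state_time N T) \<and>
     (\<forall>i\<in>{0, 1}. \<forall>n\<in>{0..N}. continuous_on {0..T} (\<lambda>t. \<beta> (i, n, t)))"

text \<open>Whenever an argument of \<open>\<beta>\<close> leaves the domain (or the natural subtraction truncates), the
  prefactor is 0: at \<open>n = N\<close> for the first rate, at \<open>n = 0\<close> for the second.\<close>

definition gamma_plus ::
  "nat \<Rightarrow> (nat \<times> nat \<times> real \<Rightarrow> real) \<Rightarrow> nat \<Rightarrow> nat \<Rightarrow> real \<Rightarrow> real" where
  "gamma_plus N \<beta> i n t = real (N - n) * \<beta> (1, n + 1 - i, t)"

definition gamma_minus ::
  "(nat \<times> nat \<times> real \<Rightarrow> real) \<Rightarrow> nat \<Rightarrow> nat \<Rightarrow> real \<Rightarrow> real" where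
  "gamma_minus \<beta> i n t = real n * \<beta> (0, n - i, t)"

definition is_value_function ::
  "(nat \<Rightarrow> real \<Rightarrow> real \<Rightarrow> real) \<Rightarrow> (nat \<Rightarrow> real \<Rightarrow> real) \<Rightarrow> nat \<Rightarrow> real \<Rightarrow>
   (nat \<times> nat \<times> real \<Rightarrow> real) \<Rightarrow> (nat \<times> nat \<times> real \<Rightarrow> real) \<Rightarrow> bool" where
  "is_value_function c \<psi> N T \<beta> \<phi> \<longleftrightarrow>
     \<phi> \<in> extensional (state_time N T) \<and>
     (\<forall>i\<in>{0, 1}. \<forall>n\<in>{0..N}. \<forall>t\<in>{0..T}.
       ((\<lambda>s. \<phi> (i, n, s)) has_real_derivative
         - (gamma_plus N \<beta> i n t * (\<phi> (i, n + 1, t) - \<phi> (i, n, t))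
            + gamma_minus \<beta> i n t * (\<phi> (i, n - 1, t) - \<phi> (i, n, t))
            + hamiltonian c (\<phi> (1 - i, n, t) - \<phi> (i, n, t)) (real n / real N) i))
       (at t within {0..T})) \<and>
     (\<forall>i\<in>{0, 1}. \<forall>n\<in>{0..N}. \<phi> (i, n, T) = \<psi> i (real n / real N))"

text \<open>For admissible \<open>\<beta>\<close> and costs satisfying the assumptions above, the terminal value problem has
  exactly one solution, so the description below denotes it.\<close>

definition value_function ::
  "(nat \<Rightarrow> real \<Rightarrow> real \<Rightarrow> real) \<Rightarrow> (nat \<Rightarrow> real \<Rightarrow> real) \<Rightarrow> nat \<Rightarrow> real \<Rightarrow>
   (nat \<times> nat \<times> real \<Rightarrow> real) \<Rightarrow> (nat \<times> nat \<times> real \<Rightarrow> real)" where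
  "value_function c \<psi> N T \<beta> = (THE \<phi>. is_value_function c \<psi> N T \<beta> \<phi>)"

definition best_response ::
  "(nat \<Rightarrow> real \<Rightarrow> real \<Rightarrow> real) \<Rightarrow> (nat \<Rightarrow> real \<Rightarrow> real) \<Rightarrow> nat \<Rightarrow> real \<Rightarrow>
   (nat \<times> nat \<times> real \<Rightarrow> real) \<Rightarrow> (nat \<times> nat \<times> real \<Rightarrow> real)" where
  "best_response c \<psi> N T \<beta> =
     (let \<phi> = value_function c \<psi> N T \<beta> in
      restrict (\<lambda>(i, n, t). opt_rate c (\<phi> (1 - i, n, t) - \<phi> (i, n, t)) (real n / real N) i)
        (state_time N T))"

definition nash_equilibrium ::
  "(nat \<Rightarrow> real \<Rightarrow> real \<Rightarrow> real) \<Rightarrow> (nat \<Rightarrow> real \<Rightarrow> real) \<Rightarrow> nat \<Rightarrow> real \<Rightarrow>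
   (nat \<times> nat \<times> real \<Rightarrow> real) \<Rightarrow> bool" where
  "nash_equilibrium c \<psi> N T \<beta> \<longleftrightarrow> admissible N T \<beta> \<and> best_response c \<psi> N T \<beta> = \<beta>"

end

theory Submission
  imports Defs "HOL-Probability.Discrete_Topology"
begin

text \<open>A control is a Nash equilibrium iff it is the feedback control of its own value function, so
  equilibria correspond to solutions of the closed-loop system, in which the rates are replaced by
  the optimal rates of the unknown. Like the equation for a given control, this is a terminal
  value problem on a finite set of states. By uniform convexity, the optimal rate is Lipschitz
  and the Hamiltonian locally Lipschitz in the momentum, so the vector field is locally Lipschitz
  and solutions are unique. Where the unknown is maximal over the states, the jump terms are
  nonpositive and the Hamiltonian is at most the running cost of the rate 0; where it is minimal,
  both are nonnegative. This gives an a priori bound, hence existence on all of \<open>[0, T]\<close>.\<close>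

section \<open>Terminal value problems on finite index sets\<close>

text \<open>In the closed loop, rates growing up to linearly with the values multiply differences of
  values. The field is thus of quadratic type, and a local Lipschitz bound alone does not exclude
  blow-up before time 0. The sign conditions do, because they hold for all nonnegative rates,
  however large: the bound involves only the terminal data, \<open>T\<close> and the running costs
  at rate 0. Hence one solvability theorem, with the rates as a parameter, serves both systems.

  The open-loop system cannot be bypassed. The value function is a definite description, so a
  closed-loop solution is recognised as the value function of its feedback only through uniqueness
  for the open loop. Equilibria then come from a differential equation and not from iterating the
  best response.

  Uniqueness and the a priori bound share one device: a maximum over all states and the whole time
  interval at once. Weights that depend on time alone keep the order of the states, so the Lipschitz
  and sign conditions apply at that maximum.\<close>

lemma max_over_finite_times_interval:
  fixes w :: "'k \<Rightarrow> real \<Rightarrow> real"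
  assumes "finite S" "S \<noteq> {}" "0 \<le> T"
    and der: "\<And>k t. k \<in> S \<Longrightarrow> t \<in> {0..T} \<Longrightarrow>
      (w k has_real_derivative w' k t) (at t within {0..T})"
  shows "\<exists>s\<in>S. \<exists>t\<in>{0..T}. (\<forall>k\<in>S. \<forall>u\<in>{0..T}. w k u \<le> w s t) \<and> (t = T \<or> w' s t \<le> 0)"
proof -
  have cont: "continuous_on {0..T} (w k)" if "k \<in> S" for k
    using der[OF that] by (rule DERIV_continuous_on)
  have "\<exists>t\<in>{0..T}. \<forall>u\<in>{0..T}. w k u \<le> w k t" if "k \<in> S" for k
    using continuous_attains_sup[OF _ _ cont[OF that]] \<open>0 \<le> T\<close> by auto
  then obtain \<tau> where \<tau>: "\<And>k. k \<in> S \<Longrightarrow> \<tau> k \<in> {0..T}"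
    "\<And>k u. k \<in> S \<Longrightarrow> u \<in> {0..T} \<Longrightarrow> w k u \<le> w k (\<tau> k)"
    by metis
  define M where "M = (\<lambda>k. w k (\<tau> k)) ` S"
  have "Max M \<in> M" using assms(1,2) by (intro Max_in) (auto simp: M_def)
  then obtain s where s: "s \<in> S" "Max M = w s (\<tau> s)" by (auto simp: M_def)
  have s_max: "w k (\<tau> k) \<le> w s (\<tau> s)" if "k \<in> S" for k
    using assms(1) that unfolding s(2)[symmetric] by (intro Max_ge) (auto simp: M_def)
  have max: "w k u \<le> w s (\<tau> s)" if "k \<in> S" "u \<in> {0..T}" for k u
    using \<tau>(2)[OF that] s_max[OF that(1)] by simp
  \<comment> \<open>A positive derivative would give a larger value slightly to the right. This
    works at time 0 too, but there is no room at \<open>T\<close>, whence the exceptional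
    case.\<close>
  have "w' s (\<tau> s) \<le> 0" if "\<tau> s \<noteq> T"
  proof (rule ccontr)
    assume "\<not> w' s (\<tau> s) \<le> 0"
    then obtain d where d: "d > 0"
      "\<And>h. h > 0 \<Longrightarrow> \<tau> s + h \<in> {0..T} \<Longrightarrow> h < d \<Longrightarrow> w s (\<tau> s) < w s (\<tau> s + h)"
      using has_real_derivative_pos_inc_right[OF der[OF s(1) \<tau>(1)[OF s(1)]]] by force
    define h where "h = min (d / 2) (T - \<tau> s)"
    have "h > 0" "h < d" "\<tau> s + h \<in> {0..T}"
      using d(1) that \<tau>(1)[OF s(1)] by (auto simp: h_def min_def field_simps)
    with d(2)[of h] max[OF s(1), of "\<tau> s + h"] show False by fastforce
  qed
  with s(1) \<tau>(1)[OF s(1)] max show ?thesis by blast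
qed

text \<open>\<open>F\<close> is the right-hand side for minus the time derivative, as in the value
  equation. It receives a function on all of \<open>'k\<close>; the Lipschitz conditions imposed
  later compare arguments on \<open>S\<close> only and so force \<open>F\<close> to ignore the
  components outside \<open>S\<close>.\<close>

definition solves_tvp ::
  "real \<Rightarrow> 'k set \<Rightarrow> (real \<Rightarrow> ('k \<Rightarrow> real) \<Rightarrow> 'k \<Rightarrow> real) \<Rightarrow> ('k \<Rightarrow> real) \<Rightarrow> ('k \<Rightarrow> real \<Rightarrow> real) \<Rightarrow> bool"
  where "solves_tvp T S F p x \<longleftrightarrow>
    (\<forall>k\<in>S. x k T = p k \<and> (\<forall>t\<in>{0..T}.
      (x k has_real_derivative - F t (\<lambda>j. x j t) k) (at t within {0..T})))"

lemma solves_tvpD: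
  assumes "solves_tvp T S F p x" "k \<in> S"
  shows "x k T = p k"
    and "t \<in> {0..T} \<Longrightarrow> (x k has_real_derivative - F t (\<lambda>j. x j t) k) (at t within {0..T})"
  using assms by (auto simp: solves_tvp_def)

lemma solves_tvp_continuous_on:
  assumes "solves_tvp T S F p x" "k \<in> S"
  shows "continuous_on {0..T} (x k)"
  using solves_tvpD(2)[OF assms] by (rule DERIV_continuous_on)

lemma bounded_family_on_interval:
  fixes x :: "'k \<Rightarrow> real \<Rightarrow> real"
  assumes "finite S" "\<And>k. k \<in> S \<Longrightarrow> continuous_on {0..T} (x k)"
  shows "\<exists>R. \<forall>k\<in>S. \<forall>t\<in>{0..T}. \<bar>x k t\<bar> \<le> R"
proof -
  have "bounded (\<Union>k\<in>S. x k ` {0..T})"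
    using assms by (auto intro!: compact_imp_bounded compact_continuous_image)
  then show ?thesis by (auto simp: bounded_iff)
qed

text \<open>Maximise the squared difference of the two solutions with an exponential time weight. At
  the maximum the component \<open>s\<close> has the largest difference, so the Lipschitz bound
  there involves this difference alone. Both solutions are bounded on the compact interval, so a
  single local constant suffices.\<close>

lemma tvp_unique:
  assumes "finite S" "0 \<le> T"
    and lip: "\<And>R. \<exists>L. \<forall>t\<in>{0..T}. \<forall>x y d. (\<forall>j\<in>S. \<bar>x j\<bar> \<le> R \<and> \<bar>y j\<bar> \<le> R \<and> \<bar>x j - y j\<bar> \<le> d) \<longrightarrow>
      (\<forall>k\<in>S. \<bar>F t x k - F t y k\<bar> \<le> L * d)"
    and x: "solves_tvp T S F p x" and y: "solves_tvp T S F p y"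
    and "k \<in> S" "t \<in> {0..T}"
  shows "x k t = y k t"
proof -
  obtain R1 where R1: "\<And>k t. k \<in> S \<Longrightarrow> t \<in> {0..T} \<Longrightarrow> \<bar>x k t\<bar> \<le> R1"
    using bounded_family_on_interval[of S T x, OF assms(1) solves_tvp_continuous_on[OF x]] by blast
  obtain R2 where R2: "\<And>k t. k \<in> S \<Longrightarrow> t \<in> {0..T} \<Longrightarrow> \<bar>y k t\<bar> \<le> R2"
    using bounded_family_on_interval[of S T y, OF assms(1) solves_tvp_continuous_on[OF y]] by blast
  have R: "\<bar>x k t\<bar> \<le> max R1 R2 \<and> \<bar>y k t\<bar> \<le> max R1 R2" if "k \<in> S" "t \<in> {0..T}" for k t
    using R1[OF that] R2[OF that] by auto
  obtain L where L: "\<And>t x y d k. t \<in> {0..T} \<Longrightarrow>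
     (\<forall>j\<in>S. \<bar>x j\<bar> \<le> max R1 R2 \<and> \<bar>y j\<bar> \<le> max R1 R2 \<and> \<bar>x j - y j\<bar> \<le> d) \<Longrightarrow> k \<in> S \<Longrightarrow>
     \<bar>F t x k - F t y k\<bar> \<le> L * d"
    using lip[of "max R1 R2"] by blast
  define e where "e k t = x k t - y k t" for k t
  \<comment> \<open>The exponent has \<open>L + 1\<close> and not \<open>L\<close>: at a maximum
    over the states the derivative of \<open>w\<close> is then at least
    \<open>2 * E t * (e k t)\<^sup>2\<close>, so a maximum before \<open>T\<close> forces the
    difference to vanish.\<close>
  define E where "E t = exp (- 2 * (L + 1) * (T - t))" for t
  define w where "w k t = (e k t)\<^sup>2 * E t" for k t
  define e' where "e' k t = - (F t (\<lambda>j. x j t) k - F t (\<lambda>j. y j t) k)" for k t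
  have e': "(e k has_real_derivative e' k t) (at t within {0..T})" if "k \<in> S" "t \<in> {0..T}" for k t
    unfolding e_def[abs_def] e'_def
    by (rule derivative_eq_intros solves_tvpD(2)[OF x that] solves_tvpD(2)[OF y that])+ simp
  have E': "(E has_real_derivative 2 * (L + 1) * E t) (at t within {0..T})" for t
    unfolding E_def[abs_def] by (auto intro!: derivative_eq_intros)
  have w': "(w k has_real_derivative 2 * E t * (e k t * e' k t + (L + 1) * (e k t)\<^sup>2)) (at t within {0..T})"
    if "k \<in> S" "t \<in> {0..T}" for k t
    unfolding w_def[abs_def]
    by (rule derivative_eq_intros e'[OF that] E' refl)+ (simp add: algebra_simps power2_eq_square)
  have "S \<noteq> {}" using \<open>k \<in> S\<close> by auto
  obtain s u where su: "s \<in> S" "u \<in> {0..T}" "\<forall>k\<in>S. \<forall>t\<in>{0..T}. w k t \<le> w s u"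
    "u = T \<or> 2 * E u * (e s u * e' s u + (L + 1) * (e s u)\<^sup>2) \<le> 0"
    using max_over_finite_times_interval[of S T w, OF assms(1) \<open>S \<noteq> {}\<close> assms(2) w'] by blast
  have Epos: "E t > 0" for t by (simp add: E_def)
  have "w s u = 0"
    using su(4)
  proof
    assume "u = T"
    then show ?thesis using x y su(1) by (simp add: w_def e_def solves_tvpD(1)[OF x] solves_tvpD(1)[OF y])
  next
    assume le: "2 * E u * (e s u * e' s u + (L + 1) * (e s u)\<^sup>2) \<le> 0"
    have "\<bar>e j u\<bar> \<le> \<bar>e s u\<bar>" if "j \<in> S" for j
      using su(3)[rule_format, OF that su(2)] Epos[of u] by (simp add: w_def abs_le_square_iff)
    then have "\<bar>e' s u\<bar> \<le> L * \<bar>e s u\<bar>"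
      unfolding e'_def abs_minus_cancel using R su(1,2) by (intro L) (auto simp: e_def)
    then have "\<bar>e s u * e' s u\<bar> \<le> L * (e s u)\<^sup>2"
      using mult_left_mono[of "\<bar>e' s u\<bar>" "L * \<bar>e s u\<bar>" "\<bar>e s u\<bar>"]
      by (simp add: abs_mult power2_eq_square mult.left_commute)
    moreover have "e s u * e' s u + (L + 1) * (e s u)\<^sup>2 \<le> 0"
      using le Epos[of u] by (simp add: mult_le_0_iff)
    ultimately have "(e s u)\<^sup>2 \<le> 0" unfolding distrib_right by linarith
    then show ?thesis by (simp add: w_def)
  qed
  then have "(e k t)\<^sup>2 * E t \<le> 0"
    using su(3)[rule_format, OF assms(6,7)] unfolding w_def by linarith
  then have "e k t = 0" using Epos[of t] by (simp add: mult_le_0_iff)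
  then show ?thesis by (simp add: e_def)
qed

lemma tvp_upper_bound:
  assumes "finite S" "0 \<le> T" and x: "solves_tvp T S F p x"
    and max: "\<And>t s z. t \<in> {0..T} \<Longrightarrow> s \<in> S \<Longrightarrow> (\<And>j. j \<in> S \<Longrightarrow> z j \<le> z s) \<Longrightarrow> F t z s \<le> K"
    and p: "\<And>j. j \<in> S \<Longrightarrow> p j \<le> P" and "0 \<le> K"
    and k: "k \<in> S" and t: "t \<in> {0..T}"
  shows "x k t \<le> P + (K + 1) * T"
proof -
  \<comment> \<open>With slope \<open>K + 1\<close>, the derivative of \<open>w\<close> at a maximal
    component is at least 1. The maximum therefore sits at \<open>T\<close>, where the terminal data
    bound it.\<close>
  define w where "w k t = x k t - (K + 1) * (T - t)" for k t
  have w': "(w k has_real_derivative - F t (\<lambda>j. x j t) k + (K + 1)) (at t within {0..T})"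
    if "k \<in> S" "t \<in> {0..T}" for k t
    unfolding w_def[abs_def]
    by (rule derivative_eq_intros solves_tvpD(2)[OF x that] refl)+ simp
  have "S \<noteq> {}" using \<open>k \<in> S\<close> by auto
  obtain s u where su: "s \<in> S" "u \<in> {0..T}" "\<forall>k\<in>S. \<forall>t\<in>{0..T}. w k t \<le> w s u"
    "u = T \<or> - F u (\<lambda>j. x j u) s + (K + 1) \<le> 0"
    using max_over_finite_times_interval[of S T w, OF assms(1) \<open>S \<noteq> {}\<close> assms(2) w'] by blast
  have "F u (\<lambda>j. x j u) s \<le> K"
    using su(3)[rule_format, OF _ su(2)] by (intro max su) (auto simp: w_def)
  with su(4) have "u = T" by auto
  then have "w s u \<le> P" using p su(1) by (simp add: w_def solves_tvpD(1)[OF x])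
  then have "x k t \<le> P + (K + 1) * (T - t)"
    using su(3)[rule_format, OF k t] by (simp add: w_def)
  also have "\<dots> \<le> P + (K + 1) * T"
    using t \<open>0 \<le> K\<close> by (intro add_left_mono mult_left_mono) auto
  finally show ?thesis .
qed

lemma tvp_abs_bound:
  assumes "finite S" "0 \<le> T" and x: "solves_tvp T S F p x"
    and max: "\<And>t s z. t \<in> {0..T} \<Longrightarrow> s \<in> S \<Longrightarrow> (\<And>j. j \<in> S \<Longrightarrow> z j \<le> z s) \<Longrightarrow> F t z s \<le> K"
    and min: "\<And>t s z. t \<in> {0..T} \<Longrightarrow> s \<in> S \<Longrightarrow> (\<And>j. j \<in> S \<Longrightarrow> z s \<le> z j) \<Longrightarrow> - K \<le> F t z s"
    and p: "\<And>j. j \<in> S \<Longrightarrow> \<bar>p j\<bar> \<le> P" and "0 \<le> K"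
    and k: "k \<in> S" and t: "t \<in> {0..T}"
  shows "\<bar>x k t\<bar> \<le> P + (K + 1) * T"
proof -
  have "x k t \<le> P + (K + 1) * T"
    using p by (intro tvp_upper_bound[OF assms(1-3) max _ assms(7-9)]) (auto simp: abs_le_iff)
  \<comment> \<open>Reflection exchanges maximal and minimal components, so the lower bound is the
    upper bound for the reflected system.\<close>
  moreover have neg: "solves_tvp T S (\<lambda>t z k. - F t (\<lambda>j. - z j) k) (\<lambda>j. - p j) (\<lambda>k t. - x k t)"
    using x unfolding solves_tvp_def by (auto intro!: derivative_eq_intros)
  have "- x k t \<le> P + (K + 1) * T"
  proof (rule tvp_upper_bound[OF assms(1,2) neg _ _ assms(7-9)])
    show "- F t (\<lambda>j. - z j) s \<le> K" if "t \<in> {0..T}" "s \<in> S" "\<And>j. j \<in> S \<Longrightarrow> z j \<le> z s" for t s z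
      using min[of t s "\<lambda>j. - z j"] that by simp
  qed (use p in \<open>auto simp: abs_le_iff\<close>)
  ultimately show ?thesis by simp
qed

text \<open>Each slice over a discrete index is open. This allows a family of continuous functions
  of time to be one bounded continuous function on \<open>'k discrete \<times> real\<close>, an
  element of a complete metric space type to which the Banach fixed point theorem applies.\<close>

lemma continuous_on_discrete_Times:
  fixes f :: "'k discrete \<times> real \<Rightarrow> real"
  assumes cont: "\<And>k. continuous_on UNIV (\<lambda>t. f (k, t))"
  shows "continuous_on UNIV f"
proof (rule iffD2[OF continuous_on_open_vimage[OF open_UNIV]], intro allI impI)
  fix B :: "real set" assume "open B"
  have "f -` B \<inter> UNIV = (\<Union>k. {k} \<times> ((\<lambda>t. f (k, t)) -` B))" by auto
  also have "open \<dots>"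
    using \<open>open B\<close> cont
    by (intro open_UN ballI open_Times open_discrete) (auto intro: open_vimage)
  finally show "open (f -` B \<inter> UNIV)" .
qed

text \<open>Picard iteration in the unknown \<open>exp (-2 * L * (T - t)) * x k t\<close>, for which the
  integral operator contracts with factor 1/2 on the whole interval.\<close>

lemma tvp_exists_global_lipschitz:
  fixes F :: "real \<Rightarrow> ('k \<Rightarrow> real) \<Rightarrow> 'k \<Rightarrow> real"
  assumes "finite S" "0 \<le> T"
    and cont: "\<And>x k. \<forall>j\<in>S. continuous_on {0..T} (x j) \<Longrightarrow> k \<in> S \<Longrightarrow>
      continuous_on {0..T} (\<lambda>t. F t (\<lambda>j. x j t) k)"
    and lip: "\<forall>t\<in>{0..T}. \<forall>x y d. (\<forall>j\<in>S. \<bar>x j - y j\<bar> \<le> d) \<longrightarrow>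
      (\<forall>k\<in>S. \<bar>F t x k - F t y k\<bar> \<le> L0 * d)"
  shows "\<exists>x. solves_tvp T S F p x"
proof -
  define L where "L = max 1 L0"
  have "L > 0" by (simp add: L_def)
  have lip': "\<bar>F t x k - F t y k\<bar> \<le> L * d"
    if "t \<in> {0..T}" "\<forall>j\<in>S. \<bar>x j - y j\<bar> \<le> d" "k \<in> S" for t x y d k
  proof -
    have "\<bar>F t x k - F t y k\<bar> \<le> L0 * d" using lip that by blast
    also have "0 \<le> d" using that by (meson abs_ge_zero order_trans)
    then have "L0 * d \<le> L * d" by (intro mult_right_mono) (auto simp: L_def)
    finally show ?thesis .
  qed
  define E where "E t = exp (2 * L * (T - t))" for t
  have [simp]: "E t > 0" "E t \<noteq> 0" "\<bar>E t\<bar> = E t" for t by (auto simp: E_def)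
  have contE: "continuous_on A E" for A
    unfolding E_def[abs_def] by (intro continuous_intros)
  define G where "G y k s = F s (\<lambda>j. E s * apply_bcontfun y (discrete j, s)) k"
    for y :: "('k discrete \<times> real) \<Rightarrow>\<^sub>C real" and k s
  have contG: "continuous_on {0..T} (G y k)" if "k \<in> S" for y k
    unfolding G_def[abs_def] using that
    by (intro cont ballI continuous_intros contE)
       (auto intro!: continuous_on_compose2[OF continuous_on_apply_bcontfun[of UNIV]] continuous_intros)
  define J where "J y k t = (p k + integral {t..T} (G y k)) / E t" for y k t
  have contJ: "continuous_on {0..T} (J y k)" if "k \<in> S" for y k
  proof -
    have "continuous_on {0..T} (\<lambda>t. integral {t..T} (G y k))"
      using integral_has_real_derivative'[OF contG[OF that]] by (rule DERIV_continuous_on)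
    then show ?thesis unfolding J_def[abs_def] by (intro continuous_intros contE) auto
  qed
  \<comment> \<open>The functions of the Banach space live on the whole real line, so time is
    clamped to the interval; indices outside \<open>S\<close> get the value 0 in
    \<open>op\<close>.\<close>
  define cl where "cl t = max 0 (min T t)" for t :: real
  have cl: "cl t \<in> {0..T}" for t using \<open>0 \<le> T\<close> by (auto simp: cl_def)
  have cl_id: "cl t = t" if "t \<in> {0..T}" for t using that by (auto simp: cl_def)
  define op where "op y = (\<lambda>(k, t). if of_discrete k \<in> S then J y (of_discrete k) (cl t) else 0)" for y
  have op: "op y \<in> bcontfun" for y
  proof -
    have "continuous_on UNIV (\<lambda>t. op y (k, t))" for k
    proof (cases "of_discrete k \<in> S")
      case True
      then show ?thesis using cl
        by (auto simp: op_def cl_def[abs_def] intro!: continuous_on_compose2[OF contJ] continuous_intros)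
    qed (simp add: op_def)
    then have "continuous_on UNIV (op y)"
      by (rule continuous_on_discrete_Times)
    moreover obtain R where R: "\<forall>k\<in>S. \<forall>t\<in>{0..T}. \<bar>J y k t\<bar> \<le> R"
      using bounded_family_on_interval[of S T "J y", OF \<open>finite S\<close> contJ] by blast
    have "norm (op y z) \<le> \<bar>R\<bar>" for z
      using R cl[of "snd z"] by (cases z) (force simp: op_def)
    ultimately show ?thesis by (rule bcontfun_normI)
  qed
  have "dist (Bcontfun (op y)) (Bcontfun (op z)) \<le> (1/2) * dist y z" for y z
  proof (rule dist_bound)
    fix v :: "'k discrete \<times> real"
    obtain k t where v: "v = (discrete k, t)" by (cases v, metis of_discrete_inverse)
    show "dist (apply_bcontfun (Bcontfun (op y)) v) (apply_bcontfun (Bcontfun (op z)) v) \<le> (1/2) * dist y z"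
    proof (cases "k \<in> S")
      case False
      then show ?thesis unfolding Bcontfun_inverse[OF op] by (simp add: op_def v discrete_inverse)
    next
      case True
      define u where "u = cl t"
      have u: "u \<in> {0..T}" unfolding u_def by (rule cl)
      have int: "G w k integrable_on {u..T}" for w
        using u by (auto intro!: integrable_continuous_interval continuous_on_subset[OF contG[OF True]])
      have G: "\<bar>G y k s - G z k s\<bar> \<le> L * (E s * dist y z)" if "s \<in> {u..T}" for s
        unfolding G_def
      proof (rule lip')
        show "\<forall>j\<in>S. \<bar>E s * apply_bcontfun y (discrete j, s) - E s * apply_bcontfun z (discrete j, s)\<bar> \<le> E s * dist y z"
          using dist_bounded[of y _ z]
          by (auto simp: abs_mult dist_real_def simp flip: right_diff_distrib)
      qed (use that u True in auto)
      \<comment> \<open>The derivative of \<open>E\<close> is \<open>- 2 * L * E\<close>, so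
        integrating \<open>L * E\<close> gives half a difference of values of \<open>E\<close>.
        After division by \<open>E u\<close> this is the contraction factor 1/2, whatever the length
        of the interval.\<close>
      have intE: "((\<lambda>s. L * (E s * dist y z)) has_integral
          (- (E T * dist y z / 2)) - (- (E u * dist y z / 2))) {u..T}"
        using u unfolding E_def
        by (intro fundamental_theorem_of_calculus)
           (auto intro!: derivative_eq_intros simp flip: has_real_derivative_iff_has_vector_derivative)
      have "\<bar>integral {u..T} (G y k) - integral {u..T} (G z k)\<bar>
          = norm (integral {u..T} (\<lambda>s. G y k s - G z k s))"
        by (simp add: Henstock_Kurzweil_Integration.integral_diff[OF int int])
      also have "\<dots> \<le> integral {u..T} (\<lambda>s. L * (E s * dist y z))"
        using G intE int
        by (intro integral_norm_bound_integral integrable_diff) (auto simp: has_integral_iff)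
      also have "\<dots> = E u * dist y z / 2 - E T * dist y z / 2"
        using intE by (simp add: has_integral_iff)
      also have "\<dots> \<le> E u * dist y z / 2" by (simp add: E_def)
      finally have "\<bar>J y k u - J z k u\<bar> \<le> dist y z / 2"
        by (simp add: J_def field_simps abs_mult flip: diff_divide_distrib)
      then show ?thesis
        using True unfolding Bcontfun_inverse[OF op] by (simp add: op_def v u_def dist_real_def discrete_inverse)
    qed
  qed
  then obtain y where y: "Bcontfun (op y) = y"
    using banach_fix_type[of "1/2" "\<lambda>y. Bcontfun (op y)"] by auto
  have fixp: "E t * apply_bcontfun y (discrete k, t) = p k + integral {t..T} (G y k)"
    if "k \<in> S" "t \<in> {0..T}" for k t
  proof -
    have "apply_bcontfun y (discrete k, t) = op y (discrete k, t)"
      using Bcontfun_inverse[OF op, of y] y by simp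
    then show ?thesis using that by (simp add: op_def J_def cl_id discrete_inverse)
  qed
  have "solves_tvp T S F p (\<lambda>k t. E t * apply_bcontfun y (discrete k, t))"
    unfolding solves_tvp_def
  proof (intro ballI conjI)
    fix k assume k: "k \<in> S"
    show "E T * apply_bcontfun y (discrete k, T) = p k"
      using fixp[OF k, of T] \<open>0 \<le> T\<close> by simp
    fix t assume t: "t \<in> {0..T}"
    have "((\<lambda>t. p k + integral {t..T} (G y k)) has_real_derivative - G y k t) (at t within {0..T})"
      using DERIV_add[OF DERIV_const integral_has_real_derivative'[OF contG[OF k] t], of "p k" y] by simp
    then have "((\<lambda>t. E t * apply_bcontfun y (discrete k, t)) has_real_derivative - G y k t) (at t within {0..T})"
      by (rule has_field_derivative_transform_within[OF _ zero_less_one t]) (simp add: fixp k)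
    then show "((\<lambda>t. E t * apply_bcontfun y (discrete k, t)) has_real_derivative
        - F t (\<lambda>j. E t * apply_bcontfun y (discrete j, t)) k) (at t within {0..T})"
      by (simp add: G_def)
  qed
  then show ?thesis by blast
qed

text \<open>Truncating the argument of \<open>F\<close> to a box keeps the sign conditions at maximal and minimal
  components, since truncation is monotone. So the a priori bound already applies to the
  truncated problem, and for a large box the truncation is inactive.\<close>

lemma tvp_exists:
  fixes F :: "real \<Rightarrow> ('k \<Rightarrow> real) \<Rightarrow> 'k \<Rightarrow> real"
  assumes "finite S" "0 \<le> T"
    and cont: "\<And>x k. \<forall>j\<in>S. continuous_on {0..T} (x j) \<Longrightarrow> k \<in> S \<Longrightarrow>
      continuous_on {0..T} (\<lambda>t. F t (\<lambda>j. x j t) k)"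
    and lip: "\<And>R. \<exists>L. \<forall>t\<in>{0..T}. \<forall>x y d. (\<forall>j\<in>S. \<bar>x j\<bar> \<le> R \<and> \<bar>y j\<bar> \<le> R \<and> \<bar>x j - y j\<bar> \<le> d) \<longrightarrow>
      (\<forall>k\<in>S. \<bar>F t x k - F t y k\<bar> \<le> L * d)"
    and max: "\<And>t s z. t \<in> {0..T} \<Longrightarrow> s \<in> S \<Longrightarrow> (\<And>j. j \<in> S \<Longrightarrow> z j \<le> z s) \<Longrightarrow> F t z s \<le> K"
    and min: "\<And>t s z. t \<in> {0..T} \<Longrightarrow> s \<in> S \<Longrightarrow> (\<And>j. j \<in> S \<Longrightarrow> z s \<le> z j) \<Longrightarrow> - K \<le> F t z s"
    and "0 \<le> K"
  shows "\<exists>x. solves_tvp T S F p x"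
proof -
  define P where "P = (\<Sum>j\<in>S. \<bar>p j\<bar>)"
  have P: "\<bar>p j\<bar> \<le> P" if "j \<in> S" for j
    unfolding P_def using \<open>finite S\<close> that by (auto intro: member_le_sum)
  have "P \<ge> 0" unfolding P_def by (auto intro: sum_nonneg)
  \<comment> \<open>This is the a priori bound for terminal data of size \<open>P\<close>. It
    depends on \<open>F\<close> only through \<open>K\<close>, which truncation does not
    change.\<close>
  define R where "R = P + (K + 1) * T"
  have "R \<ge> 0" using \<open>P \<ge> 0\<close> \<open>0 \<le> K\<close> \<open>0 \<le> T\<close> by (simp add: R_def)
  define tr where "tr r = Orderings.max (- R) (Orderings.min R r)" for r
  have tr: "mono tr" "\<bar>tr r\<bar> \<le> R" "\<bar>tr r - tr r'\<bar> \<le> \<bar>r - r'\<bar>" for r r'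
    using \<open>R \<ge> 0\<close> by (auto simp: tr_def mono_def)
  define F' where "F' t z = F t (\<lambda>j. tr (z j))" for t z
  obtain L where L: "\<And>t x y d k. t \<in> {0..T} \<Longrightarrow>
     (\<forall>j\<in>S. \<bar>x j\<bar> \<le> R \<and> \<bar>y j\<bar> \<le> R \<and> \<bar>x j - y j\<bar> \<le> d) \<Longrightarrow> k \<in> S \<Longrightarrow>
     \<bar>F t x k - F t y k\<bar> \<le> L * d"
    using lip[of R] by blast
  have "\<exists>x. solves_tvp T S F' p x"
  proof (rule tvp_exists_global_lipschitz[OF assms(1,2)])
    show "continuous_on {0..T} (\<lambda>t. F' t (\<lambda>j. x j t) k)"
      if "\<forall>j\<in>S. continuous_on {0..T} (x j)" "k \<in> S" for x k
      unfolding F'_def tr_def using that by (intro cont ballI continuous_intros) auto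
    show "\<forall>t\<in>{0..T}. \<forall>x y d. (\<forall>j\<in>S. \<bar>x j - y j\<bar> \<le> d) \<longrightarrow>
      (\<forall>k\<in>S. \<bar>F' t x k - F' t y k\<bar> \<le> L * d)"
      unfolding F'_def using tr by (intro ballI allI impI L) (auto intro: order_trans[OF tr(3)])
  qed
  then obtain x where x: "solves_tvp T S F' p x" ..
  have "\<bar>x k t\<bar> \<le> R" if "k \<in> S" "t \<in> {0..T}" for k t
    unfolding R_def
  proof (rule tvp_abs_bound[OF assms(1,2) x _ _ P \<open>0 \<le> K\<close> that])
    show "F' t z s \<le> K" if "t \<in> {0..T}" "s \<in> S" "\<And>j. j \<in> S \<Longrightarrow> z j \<le> z s" for t s z
      unfolding F'_def using that by (intro max monoD[OF tr(1)])
    show "- K \<le> F' t z s" if "t \<in> {0..T}" "s \<in> S" "\<And>j. j \<in> S \<Longrightarrow> z s \<le> z j" for t s z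
      unfolding F'_def using that by (intro min monoD[OF tr(1)])
  qed
  then have inactive: "tr (x k t) = x k t" if "k \<in> S" "t \<in> {0..T}" for k t
    using that by (force simp: tr_def abs_le_iff)
  have bnd: "\<bar>x k t\<bar> \<le> R" if "k \<in> S" "t \<in> {0..T}" for k t
    using inactive[OF that] tr(2)[of "x k t"] by simp
  \<comment> \<open>The truncated and the original argument are known to agree on \<open>S\<close>
    only. The Lipschitz bound with distance 0 still gives equal values of \<open>F\<close>.\<close>
  have "F' t (\<lambda>j. x j t) k = F t (\<lambda>j. x j t) k" if "k \<in> S" "t \<in> {0..T}" for k t
    using L[of t "\<lambda>j. tr (x j t)" "\<lambda>j. x j t" 0 k] that inactive bnd by (simp add: F'_def)
  with x have "solves_tvp T S F p x" by (simp add: solves_tvp_def)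
  then show ?thesis by blast
qed

section \<open>Uniformly convex costs\<close>

text \<open>The tangent at 0 gives coercivity and hence a minimizer on a compact interval. Quadratic
  growth comes from midpoint convexity, which avoids a case distinction on whether the minimizer is
  the boundary point 0.\<close>

lemma strongly_convex_plus_linear_minimizer:
  fixes f f' :: "real \<Rightarrow> real"
  assumes der: "\<And>a. 0 \<le> a \<Longrightarrow> (f has_real_derivative f' a) (at a within {0..})"
    and "\<kappa> > 0"
    and conv: "\<And>a b. 0 \<le> a \<Longrightarrow> 0 \<le> b \<Longrightarrow> f a + f' a * (b - a) + \<kappa> * \<bar>b - a\<bar>\<^sup>2 \<le> f b"
  shows "\<exists>a\<ge>0. \<forall>b\<ge>0. f a + a * p + \<kappa> / 2 * (b - a)\<^sup>2 \<le> f b + b * p"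
proof -
  \<comment> \<open>Beyond this radius the quadratic term dominates the linear part of the lower
    bound by the tangent at 0, so the objective is at least \<open>f 0\<close> there.\<close>
  define R where "R = \<bar>f' 0 + p\<bar> / \<kappa>"
  have "R \<ge> 0" using \<open>\<kappa> > 0\<close> by (simp add: R_def)
  have "continuous_on {0..R} f"
    by (rule continuous_on_subset[of "{0..}"], rule DERIV_continuous_on[where D = f'])
       (auto intro: der)
  then have "continuous_on {0..R} (\<lambda>a. f a + a * p)" by (intro continuous_intros)
  then obtain a where a: "a \<in> {0..R}" "\<And>b. b \<in> {0..R} \<Longrightarrow> f a + a * p \<le> f b + b * p"
    using continuous_attains_inf[of "{0..R}" "\<lambda>a. f a + a * p"] \<open>R \<ge> 0\<close> by auto
  have a_min: "f a + a * p \<le> f b + b * p" if "b \<ge> 0" for b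
  proof (cases "b \<le> R")
    case False
    then have "\<bar>f' 0 + p\<bar> \<le> \<kappa> * b" using \<open>\<kappa> > 0\<close> by (simp add: R_def field_simps)
    then have "0 \<le> b * (f' 0 + p + \<kappa> * b)" using that by (intro mult_nonneg_nonneg) auto
    moreover have "f 0 + f' 0 * b + \<kappa> * b\<^sup>2 \<le> f b" using conv[of 0 b] that by simp
    ultimately have "f 0 \<le> f b + b * p" by (simp add: algebra_simps power2_eq_square)
    with a(2)[of 0] \<open>R \<ge> 0\<close> show ?thesis by simp
  qed (use a that in auto)
  have "f a + a * p + \<kappa> / 2 * (b - a)\<^sup>2 \<le> f b + b * p" if "b \<ge> 0" for b
  proof -
    \<comment> \<open>Adding the convexity inequalities from \<open>m\<close> to \<open>a\<close>
      and to \<open>b\<close> cancels the derivative terms and leaves \<open>\<kappa> / 2\<close>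
      times the squared distance. Minimality of \<open>a\<close> against \<open>m\<close> then gives
      the growth.\<close>
    define m where "m = (a + b) / 2"
    have "m \<ge> 0" using that a by (simp add: m_def)
    have "f m + f' m * (a - m) + \<kappa> * \<bar>a - m\<bar>\<^sup>2 \<le> f a" "f m + f' m * (b - m) + \<kappa> * \<bar>b - m\<bar>\<^sup>2 \<le> f b"
      using conv \<open>m \<ge> 0\<close> that a by auto
    moreover have "a - m = - ((b - a) / 2)" "b - m = (b - a) / 2" by (auto simp: m_def field_simps)
    ultimately have "2 * f m + \<kappa> / 2 * (b - a)\<^sup>2 \<le> f a + f b"
      by (simp add: power_divide)
    then show ?thesis using a_min[OF \<open>m \<ge> 0\<close>] by (simp add: m_def field_simps)
  qed
  then show ?thesis using a(1) by auto
qed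

context cost_assumptions
begin

text \<open>One minimizer with quadratic growth settles both descriptions: it attains the
  \<open>LEAST\<close> value, and growth makes it the only choice for \<open>THE\<close>. The
  constant does not depend on the state or the momentum, which later makes the Lipschitz bound
  uniform.\<close>

lemma opt_rate_spec:
  "\<exists>\<kappa>>0. \<forall>i\<in>{0, 1}. \<forall>\<theta>\<in>{0..1}. \<forall>p. 0 \<le> opt_rate c p \<theta> i \<and>
     hamiltonian c p \<theta> i = c i \<theta> (opt_rate c p \<theta> i) + opt_rate c p \<theta> i * p \<and>
     (\<forall>b\<ge>0. hamiltonian c p \<theta> i + \<kappa> / 2 * (b - opt_rate c p \<theta> i)\<^sup>2 \<le> c i \<theta> b + b * p)"
proof -
  obtain \<kappa> where \<kappa>: "\<kappa> > 0" "\<forall>i\<in>{0, 1}. \<forall>\<theta>\<in>{0..1}. \<forall>\<alpha>\<ge>0. \<forall>\<alpha>'\<ge>0.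
      c i \<theta> \<alpha>' \<ge> c i \<theta> \<alpha> + c' i \<theta> \<alpha> * (\<alpha>' - \<alpha>) + \<kappa> * \<bar>\<alpha>' - \<alpha>\<bar>\<^sup>2"
    using c_uniformly_convex by blast
  have "0 \<le> opt_rate c p \<theta> i \<and>
     hamiltonian c p \<theta> i = c i \<theta> (opt_rate c p \<theta> i) + opt_rate c p \<theta> i * p \<and>
     (\<forall>b\<ge>0. hamiltonian c p \<theta> i + \<kappa> / 2 * (b - opt_rate c p \<theta> i)\<^sup>2 \<le> c i \<theta> b + b * p)"
    if i: "i \<in> {0, 1}" and \<theta>: "\<theta> \<in> {0..1}" for i \<theta> p
  proof -
    obtain a where a: "a \<ge> 0" "\<And>b. b \<ge> 0 \<Longrightarrow> c i \<theta> a + a * p + \<kappa> / 2 * (b - a)\<^sup>2 \<le> c i \<theta> b + b * p"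
      using strongly_convex_plus_linear_minimizer[of "c i \<theta>" "c' i \<theta>" \<kappa> p] c_deriv \<kappa> i \<theta> by blast
    have a_le: "c i \<theta> a + a * p \<le> c i \<theta> b + b * p" if "b \<ge> 0" for b
    proof -
      have "0 \<le> \<kappa> / 2 * (b - a)\<^sup>2" using \<kappa>(1) by simp
      with a(2)[OF that] show ?thesis by linarith
    qed
    have opt: "opt_rate c p \<theta> i = a"
      unfolding opt_rate_def
    proof (rule the_equality)
      show "is_arg_min (\<lambda>a. c i \<theta> a + a * p) ((\<le>) 0) a"
        using a(1) a_le by (auto simp: is_arg_min_linorder)
      fix b assume "is_arg_min (\<lambda>a. c i \<theta> a + a * p) ((\<le>) 0) b"
      then have b: "b \<ge> 0" "c i \<theta> b + b * p \<le> c i \<theta> a + a * p"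
        using a(1) by (auto simp: is_arg_min_linorder)
      with a(2)[of b] have "\<kappa> / 2 * (b - a)\<^sup>2 \<le> 0" by linarith
      then show "b = a" using \<open>\<kappa> > 0\<close> by (simp add: mult_le_0_iff)
    qed
    have "hamiltonian c p \<theta> i = c i \<theta> a + a * p"
      unfolding hamiltonian_def using a(1) a_le by (intro Least_equality) auto
    with opt a show ?thesis by simp
  qed
  with \<kappa>(1) show ?thesis by blast
qed

section \<open>Envelope estimates for the Hamiltonian\<close>

context
  fixes i :: nat and \<theta> :: real
  assumes i: "i \<in> {0, 1}" and \<theta>: "\<theta> \<in> {0..1}"
begin

lemma opt_rate_nonneg: "0 \<le> opt_rate c p \<theta> i"
  using opt_rate_spec i \<theta> by blast

lemma hamiltonian_eq:
  "hamiltonian c p \<theta> i = c i \<theta> (opt_rate c p \<theta> i) + opt_rate c p \<theta> i * p"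
  using opt_rate_spec i \<theta> by blast

lemma hamiltonian_le: "0 \<le> b \<Longrightarrow> hamiltonian c p \<theta> i \<le> c i \<theta> b + b * p"
proof -
  assume "0 \<le> b"
  then obtain \<kappa> where "\<kappa> > 0"
    "hamiltonian c p \<theta> i + \<kappa> / 2 * (b - opt_rate c p \<theta> i)\<^sup>2 \<le> c i \<theta> b + b * p"
    using opt_rate_spec i \<theta> by blast
  moreover from this(1) have "0 \<le> \<kappa> / 2 * (b - opt_rate c p \<theta> i)\<^sup>2" by simp
  ultimately show ?thesis by linarith
qed

lemma hamiltonian_nonneg: "0 \<le> p \<Longrightarrow> 0 \<le> hamiltonian c p \<theta> i"
  using opt_rate_nonneg[of p] c_nonneg i \<theta> unfolding hamiltonian_eq by auto

text \<open>The minimizer for one momentum is a competitor for the other, and the objective is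
  affine in the momentum with the rate as slope.\<close>

lemma hamiltonian_diff_le:
  "\<bar>hamiltonian c p \<theta> i - hamiltonian c q \<theta> i\<bar> \<le> max (opt_rate c p \<theta> i) (opt_rate c q \<theta> i) * \<bar>p - q\<bar>"
proof -
  have *: "hamiltonian c p \<theta> i - hamiltonian c q \<theta> i \<le> opt_rate c q \<theta> i * \<bar>p - q\<bar>" for p q
  proof -
    have "hamiltonian c p \<theta> i - hamiltonian c q \<theta> i \<le> opt_rate c q \<theta> i * (p - q)"
      using hamiltonian_le[OF opt_rate_nonneg[of q], of p] hamiltonian_eq[of q]
      by (simp add: algebra_simps)
    also have "\<dots> \<le> opt_rate c q \<theta> i * \<bar>p - q\<bar>"
      using opt_rate_nonneg[of q] by (intro mult_left_mono) auto
    finally show ?thesis .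
  qed
  have "opt_rate c r \<theta> i * \<bar>p - q\<bar> \<le> max (opt_rate c p \<theta> i) (opt_rate c q \<theta> i) * \<bar>p - q\<bar>"
    if "r \<in> {p, q}" for r
    using that by (intro mult_right_mono) auto
  from this[of p] this[of q] *[of p q] *[of q p] show ?thesis
    by (simp add: abs_le_iff abs_minus_commute)
qed

end

text \<open>Each minimizer is inserted into the growth inequality of the other. In the sum the costs
  cancel, and what remains compares the squared distance of the rates with its product with the
  momentum difference; this yields the constant \<open>1 / \<kappa>\<close>.\<close>

lemma opt_rate_lipschitz:
  "\<exists>M\<ge>0. \<forall>i\<in>{0, 1}. \<forall>\<theta>\<in>{0..1}. \<forall>p q. \<bar>opt_rate c p \<theta> i - opt_rate c q \<theta> i\<bar> \<le> M * \<bar>p - q\<bar>"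
proof -
  obtain \<kappa> where \<kappa>: "\<kappa> > 0" "\<And>i \<theta> p b. i \<in> {0, 1} \<Longrightarrow> \<theta> \<in> {0..1} \<Longrightarrow> b \<ge> 0 \<Longrightarrow>
     hamiltonian c p \<theta> i + \<kappa> / 2 * (b - opt_rate c p \<theta> i)\<^sup>2 \<le> c i \<theta> b + b * p"
    using opt_rate_spec by blast
  have "\<bar>opt_rate c p \<theta> i - opt_rate c q \<theta> i\<bar> \<le> 1 / \<kappa> * \<bar>p - q\<bar>"
    if i: "i \<in> {0, 1}" and \<theta>: "\<theta> \<in> {0..1}" for i \<theta> p q
  proof -
    define a b where "a = opt_rate c p \<theta> i" and "b = opt_rate c q \<theta> i"
    have "c i \<theta> a + a * p + \<kappa> / 2 * (b - a)\<^sup>2 \<le> c i \<theta> b + b * p"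
      "c i \<theta> b + b * q + \<kappa> / 2 * (a - b)\<^sup>2 \<le> c i \<theta> a + a * q"
      using \<kappa>(2)[OF i \<theta> opt_rate_nonneg[OF i \<theta>]] hamiltonian_eq[OF i \<theta>] by (metis a_def b_def)+
    then have "\<kappa> * (a - b)\<^sup>2 \<le> (b - a) * (p - q)"
      by (simp add: algebra_simps power2_eq_square)
    also have "\<dots> \<le> \<bar>a - b\<bar> * \<bar>p - q\<bar>"
      by (simp flip: abs_mult) (simp add: algebra_simps abs_if)
    finally have "\<bar>a - b\<bar> * (\<kappa> * \<bar>a - b\<bar>) \<le> \<bar>a - b\<bar> * \<bar>p - q\<bar>"
      by (simp add: power2_eq_square mult.left_commute)
    then have "a \<noteq> b \<Longrightarrow> \<kappa> * \<bar>a - b\<bar> \<le> \<bar>p - q\<bar>" by (simp add: mult_le_cancel_left)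
    then show ?thesis using \<kappa>(1) unfolding a_def[symmetric] b_def[symmetric]
      by (cases "a = b") (simp_all add: field_simps)
  qed
  then show ?thesis using \<kappa>(1) by (intro exI[of _ "1 / \<kappa>"]) auto
qed

lemma continuous_on_opt_rate:
  assumes "i \<in> {0, 1}" "\<theta> \<in> {0..1}"
  shows "continuous_on UNIV (\<lambda>p. opt_rate c p \<theta> i)"
proof -
  obtain M where "M \<ge> 0" "\<And>p q. \<bar>opt_rate c p \<theta> i - opt_rate c q \<theta> i\<bar> \<le> M * \<bar>p - q\<bar>"
    using opt_rate_lipschitz assms by blast
  then have "M-lipschitz_on UNIV (\<lambda>p. opt_rate c p \<theta> i)"
    by (intro lipschitz_onI) (auto simp: dist_real_def)
  then show ?thesis by (rule lipschitz_on_continuous_on)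
qed

text \<open>The rates may be unbounded in the momentum, so the estimate is localised: as
  \<open>p\<close> tends to \<open>q\<close>, the larger of the two rates converges, and the bound
  tends to 0.\<close>

lemma continuous_on_hamiltonian:
  assumes "i \<in> {0, 1}" "\<theta> \<in> {0..1}"
  shows "continuous_on UNIV (\<lambda>p. hamiltonian c p \<theta> i)"
  unfolding continuous_on_def
proof
  fix q :: real
  let ?a = "\<lambda>p. opt_rate c p \<theta> i"
  have a: "(?a \<longlongrightarrow> ?a q) (at q)"
    using continuous_on_opt_rate[OF assms] by (simp add: continuous_on_def)
  have "((\<lambda>p. max (?a p) (?a q) * \<bar>p - q\<bar>) \<longlongrightarrow> max (?a q) (?a q) * \<bar>q - q\<bar>) (at q)"
    by (intro tendsto_intros a)
  then have lim: "((\<lambda>p. max (?a p) (?a q) * \<bar>p - q\<bar>) \<longlongrightarrow> 0) (at q)" by simp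
  have "((\<lambda>p. hamiltonian c p \<theta> i - hamiltonian c q \<theta> i) \<longlongrightarrow> 0) (at q)"
    by (rule Lim_null_comparison[OF always_eventually lim])
       (simp only: real_norm_def hamiltonian_diff_le[OF assms] simp_thms)
  then show "((\<lambda>p. hamiltonian c p \<theta> i) \<longlongrightarrow> hamiltonian c q \<theta> i) (at q)"
    by (rule LIM_zero_cancel)
qed

end

section \<open>The Hamilton-Jacobi-Bellman system\<close>

definition states :: "nat \<Rightarrow> (nat \<times> nat) set" where
  "states N = {0, 1} \<times> {0..N}"

text \<open>\<open>b t z k\<close> is the rate at which the other players in state \<open>k\<close> switch at time \<open>t\<close>, given the
  values \<open>z\<close>. A fixed control ignores \<open>z\<close>, the equilibrium system takes \<open>b t = feedback c N\<close>.\<close>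

fun hjb :: "(nat \<Rightarrow> real \<Rightarrow> real \<Rightarrow> real) \<Rightarrow> nat \<Rightarrow> (real \<Rightarrow> (nat \<times> nat \<Rightarrow> real) \<Rightarrow> nat \<times> nat \<Rightarrow> real) \<Rightarrow>
    real \<Rightarrow> (nat \<times> nat \<Rightarrow> real) \<Rightarrow> nat \<times> nat \<Rightarrow> real" where
  "hjb c N b t z (i, n) =
     real (N - n) * b t z (1, n + 1 - i) * (z (i, n + 1) - z (i, n)) +
     real n * b t z (0, n - i) * (z (i, n - 1) - z (i, n)) +
     hamiltonian c (z (1 - i, n) - z (i, n)) (real n / real N) i"

fun feedback :: "(nat \<Rightarrow> real \<Rightarrow> real \<Rightarrow> real) \<Rightarrow> nat \<Rightarrow> (nat \<times> nat \<Rightarrow> real) \<Rightarrow> nat \<times> nat \<Rightarrow> real" where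
  "feedback c N z (i, n) = opt_rate c (z (1 - i, n) - z (i, n)) (real n / real N) i"

lemma finite_states: "finite (states N)"
  by (simp add: states_def)

text \<open>The conditional conclusions mirror the prefactors of the jump terms: neighbours and rate
  indices on the upper side matter only for \<open>n < N\<close>, those on the lower side only for
  \<open>0 < n\<close>.\<close>

lemma states_cases:
  assumes "k \<in> states N"
  obtains i n where "k = (i, n)" "i \<in> {0, 1}" "n \<le> N" "real n / real N \<in> {0..1}"
    "(i, n) \<in> states N" "(1 - i, n) \<in> states N"
    "n < N \<Longrightarrow> (i, n + 1) \<in> states N" "n < N \<Longrightarrow> (1, n + 1 - i) \<in> states N"
    "0 < n \<Longrightarrow> (i, n - 1) \<in> states N" "0 < n \<Longrightarrow> (0, n - i) \<in> states N"
  using assms by (cases k) (rule that, auto simp: states_def divide_le_eq_1)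

lemma statesD:
  assumes "k \<in> states N"
  shows "fst k \<in> {0, 1}" "real (snd k) / real N \<in> {0..1}"
  by (cases rule: states_cases[OF assms]; simp)+

text \<open>A jump term is a product, split as \<open>(b - b') * u + b' * (u - u')\<close>. The
  estimates are required for nonzero weight only, because at the ends of the grid the factors refer
  to indices outside it.\<close>

lemma weighted_product_lipschitz:
  fixes w :: real
  assumes w: "0 \<le> w" "w \<le> W"
    and "w \<noteq> 0 \<Longrightarrow> \<bar>b - b'\<bar> \<le> L * d \<and> \<bar>b'\<bar> \<le> L \<and> \<bar>u\<bar> \<le> 2 * R \<and> \<bar>u - u'\<bar> \<le> 2 * d"
    and "0 \<le> d" "0 \<le> L" "0 \<le> R"
  shows "\<bar>w * b * u - w * b' * u'\<bar> \<le> W * (L * (2 * R) + L * 2) * d"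
proof (cases "w = 0")
  case False
  then have *: "\<bar>b - b'\<bar> \<le> L * d" "\<bar>b'\<bar> \<le> L" "\<bar>u\<bar> \<le> 2 * R" "\<bar>u - u'\<bar> \<le> 2 * d" using assms by auto
  have "\<bar>w * b * u - w * b' * u'\<bar> = w * \<bar>(b - b') * u + b' * (u - u')\<bar>"
    using w by (simp add: abs_mult[of w, symmetric, unfolded abs_of_nonneg[OF w(1)]] algebra_simps flip: abs_mult)
  also have "\<dots> \<le> w * (\<bar>b - b'\<bar> * \<bar>u\<bar> + \<bar>b'\<bar> * \<bar>u - u'\<bar>)"
    using w by (intro mult_left_mono order_trans[OF abs_triangle_ineq]) (auto simp: abs_mult)
  also have "\<dots> \<le> W * (L * d * (2 * R) + L * (2 * d))"
  proof -
    have "\<bar>b - b'\<bar> * \<bar>u\<bar> \<le> L * d * (2 * R)" "\<bar>b'\<bar> * \<bar>u - u'\<bar> \<le> L * (2 * d)"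
      by (rule mult_mono; use * assms(4-6) in simp)+
    then have "\<bar>b - b'\<bar> * \<bar>u\<bar> + \<bar>b'\<bar> * \<bar>u - u'\<bar> \<le> L * d * (2 * R) + L * (2 * d)" by linarith
    then show ?thesis using w by (intro mult_mono) auto
  qed
  also have "\<dots> = W * (L * (2 * R) + L * 2) * d" by (simp add: algebra_simps)
  finally show ?thesis .
qed (use assms in auto)

lemma abs_diff_of_diffs_le:
  fixes a b :: real
  shows "\<bar>a - b\<bar> \<le> d \<Longrightarrow> \<bar>a' - b'\<bar> \<le> d \<Longrightarrow> \<bar>a - a' - (b - b')\<bar> \<le> 2 * d"
  by linarith

lemma abs_diff_of_sums_le:
  fixes u v w :: real
  shows "\<bar>u - u'\<bar> \<le> a \<Longrightarrow> \<bar>v - v'\<bar> \<le> b \<Longrightarrow> \<bar>w - w'\<bar> \<le> e \<Longrightarrow>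
    \<bar>u + v + w - (u' + v' + w')\<bar> \<le> a + b + e"
  by linarith

section \<open>Sign conditions and regularity for general rates\<close>

context cost_assumptions
begin

lemma opt_rate_affine_bound:
  "\<exists>A\<ge>0. \<exists>M\<ge>0. \<forall>i n. (i, n) \<in> states N \<longrightarrow> (\<forall>p q.
     opt_rate c p (real n / real N) i \<le> A + M * \<bar>p\<bar> \<and>
     \<bar>opt_rate c p (real n / real N) i - opt_rate c q (real n / real N) i\<bar> \<le> M * \<bar>p - q\<bar>)"
proof -
  obtain M where M: "M \<ge> 0" "\<And>i \<theta> p q. i \<in> {0, 1} \<Longrightarrow> \<theta> \<in> {0..1} \<Longrightarrow>
      \<bar>opt_rate c p \<theta> i - opt_rate c q \<theta> i\<bar> \<le> M * \<bar>p - q\<bar>"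
    using opt_rate_lipschitz by blast
  \<comment> \<open>Rates at momentum 0 are nonnegative, so their sum over the finitely many states
    bounds each of them.\<close>
  define a where "a k = opt_rate c 0 (real (snd k) / real N) (fst k)" for k
  have a_nonneg: "0 \<le> a k" if "k \<in> states N" for k
    unfolding a_def by (rule opt_rate_nonneg[OF statesD[OF that]])
  have le: "a k \<le> sum a (states N)" if "k \<in> states N" for k
    using that a_nonneg finite_states by (intro member_le_sum) auto
  have "opt_rate c p (real n / real N) i \<le> sum a (states N) + M * \<bar>p\<bar> \<and>
     \<bar>opt_rate c p (real n / real N) i - opt_rate c q (real n / real N) i\<bar> \<le> M * \<bar>p - q\<bar>"
    if "(i, n) \<in> states N" for i n p q
  proof -
    note * = M(2)[OF statesD[OF that], simplified]
    have "opt_rate c p (real n / real N) i \<le> a (i, n) + M * \<bar>p\<bar>"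
      using *[of p 0] by (simp add: a_def)
    with le[OF that] *[of p q] show ?thesis by simp
  qed
  moreover have "0 \<le> sum a (states N)" using a_nonneg by (rule sum_nonneg)
  ultimately show ?thesis using M(1) by blast
qed

text \<open>Only the sign of the rates enters. The bound contains no rate, hence it is the same for
  every control and for the feedback.\<close>

lemma hjb_le_at_max:
  assumes b: "\<And>k. k \<in> states N \<Longrightarrow> 0 \<le> b t z k"
    and k: "k \<in> states N" and max: "\<And>j. j \<in> states N \<Longrightarrow> z j \<le> z k"
  shows "hjb c N b t z k \<le> c (fst k) (real (snd k) / real N) 0"
  using k
proof (cases rule: states_cases)
  case (1 i n)
  have "real (N - n) * b t z (1, n + 1 - i) * (z (i, n + 1) - z (i, n)) \<le> 0"
  proof (cases "n < N")
    case True
    then show ?thesis using 1 b max by (intro mult_nonneg_nonpos mult_nonneg_nonneg) auto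
  qed simp
  moreover have "real n * b t z (0, n - i) * (z (i, n - 1) - z (i, n)) \<le> 0"
  proof (cases "0 < n")
    case True
    then show ?thesis using 1 b max by (intro mult_nonneg_nonpos mult_nonneg_nonneg) auto
  qed simp
  moreover have "hamiltonian c (z (1 - i, n) - z (i, n)) (real n / real N) i \<le> c i (real n / real N) 0"
    using hamiltonian_le[OF 1(2,4), of 0] by simp
  ultimately show ?thesis by (simp add: 1(1))
qed

lemma hjb_nonneg_at_min:
  assumes b: "\<And>k. k \<in> states N \<Longrightarrow> 0 \<le> b t z k"
    and k: "k \<in> states N" and min: "\<And>j. j \<in> states N \<Longrightarrow> z k \<le> z j"
  shows "0 \<le> hjb c N b t z k"
  using k
proof (cases rule: states_cases)
  case (1 i n)
  have "0 \<le> real (N - n) * b t z (1, n + 1 - i) * (z (i, n + 1) - z (i, n))"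
  proof (cases "n < N")
    case True
    then show ?thesis using 1 b min by (intro mult_nonneg_nonneg) auto
  qed simp
  moreover have "0 \<le> real n * b t z (0, n - i) * (z (i, n - 1) - z (i, n))"
  proof (cases "0 < n")
    case True
    then show ?thesis using 1 b min by (intro mult_nonneg_nonneg) auto
  qed simp
  moreover have "0 \<le> hamiltonian c (z (1 - i, n) - z (i, n)) (real n / real N) i"
    using hamiltonian_nonneg[OF 1(2,4)] min[OF 1(6)] 1(1) by simp
  ultimately show ?thesis by (simp add: 1(1))
qed

lemma hjb_continuous:
  assumes b: "\<forall>k\<in>states N. continuous_on {0..T} (\<lambda>t. b t (\<lambda>j. x j t) k)"
    and x: "\<forall>j\<in>states N. continuous_on {0..T} (x j)" and k: "k \<in> states N"
  shows "continuous_on {0..T} (\<lambda>t. hjb c N b t (\<lambda>j. x j t) k)"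
  using k
proof (cases rule: states_cases)
  case (1 i n)
  have "continuous_on {0..T} (\<lambda>t. real (N - n) * b t (\<lambda>j. x j t) (1, n + 1 - i) * (x (i, n + 1) t - x (i, n) t))"
    using 1 b x by (cases "n < N") (auto intro!: continuous_intros)
  moreover have "continuous_on {0..T} (\<lambda>t. real n * b t (\<lambda>j. x j t) (0, n - i) * (x (i, n - 1) t - x (i, n) t))"
    using 1 b x by (cases "0 < n") (auto intro!: continuous_intros)
  moreover have "continuous_on {0..T} (\<lambda>t. hamiltonian c (x (1 - i, n) t - x (i, n) t) (real n / real N) i)"
    using 1 x by (intro continuous_on_compose2[OF continuous_on_hamiltonian[OF 1(2,4)]] continuous_intros) auto
  ultimately show ?thesis unfolding 1(1) hjb.simps by (intro continuous_on_add)
qed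

text \<open>The hypothesis on the rates is stated for one box at a time, so that it covers both
  fixed controls and feedback. On the box momenta are at most \<open>2 * R\<close>, which bounds the
  optimal rate and thereby the slope of the Hamiltonian.\<close>

lemma hjb_locally_lipschitz:
  assumes b: "\<exists>L\<ge>0. \<forall>t\<in>{0..T}. \<forall>x y d. (\<forall>j\<in>states N. \<bar>x j\<bar> \<le> R \<and> \<bar>y j\<bar> \<le> R \<and> \<bar>x j - y j\<bar> \<le> d) \<longrightarrow>
      (\<forall>k\<in>states N. \<bar>b t y k\<bar> \<le> L \<and> \<bar>b t x k - b t y k\<bar> \<le> L * d)"
  shows "\<exists>L. \<forall>t\<in>{0..T}. \<forall>x y d. (\<forall>j\<in>states N. \<bar>x j\<bar> \<le> R \<and> \<bar>y j\<bar> \<le> R \<and> \<bar>x j - y j\<bar> \<le> d) \<longrightarrow>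
      (\<forall>k\<in>states N. \<bar>hjb c N b t x k - hjb c N b t y k\<bar> \<le> L * d)"
proof -
  obtain L where L: "L \<ge> 0" "\<And>t x y d k. t \<in> {0..T} \<Longrightarrow>
      \<forall>j\<in>states N. \<bar>x j\<bar> \<le> R \<and> \<bar>y j\<bar> \<le> R \<and> \<bar>x j - y j\<bar> \<le> d \<Longrightarrow> k \<in> states N \<Longrightarrow>
      \<bar>b t y k\<bar> \<le> L \<and> \<bar>b t x k - b t y k\<bar> \<le> L * d"
    using b by blast
  obtain A M where A: "A \<ge> 0" and M: "M \<ge> 0" and AM: "\<And>i n p. (i, n) \<in> states N \<Longrightarrow>
     opt_rate c p (real n / real N) i \<le> A + M * \<bar>p\<bar>"
    using opt_rate_affine_bound[of N] by blast
  \<comment> \<open>One summand for each jump term, with prefactor at most \<open>N\<close>, and one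
    for the Hamiltonian. Differences of two components are at most \<open>2 * R\<close> and vary by
    at most \<open>2 * d\<close>.\<close>
  define C where "C = N * (L * (2 * R) + L * 2) + N * (L * (2 * R) + L * 2) + (A + M * (2 * R)) * 2"
  have "\<bar>hjb c N b t x k - hjb c N b t y k\<bar> \<le> C * d"
    if t: "t \<in> {0..T}" and xy: "\<forall>j\<in>states N. \<bar>x j\<bar> \<le> R \<and> \<bar>y j\<bar> \<le> R \<and> \<bar>x j - y j\<bar> \<le> d"
      and k: "k \<in> states N" for t x y d k
    using k
  proof (cases rule: states_cases)
    case (1 i n)
    have xR: "\<bar>x j\<bar> \<le> R" and yR: "\<bar>y j\<bar> \<le> R" and xyd: "\<bar>x j - y j\<bar> \<le> d" if "j \<in> states N" for j
      using xy that by blast+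
    have d: "0 \<le> d" using xyd[OF k] by linarith
    have R: "0 \<le> R" using xR[OF k] by linarith
    have diff: "\<bar>x j - x j'\<bar> \<le> 2 * R" "\<bar>x j - x j' - (y j - y j')\<bar> \<le> 2 * d" "\<bar>y j - y j'\<bar> \<le> 2 * R"
      if "j \<in> states N" "j' \<in> states N" for j j'
      using abs_diff_of_diffs_le[of "x j" 0 R "x j'" 0] abs_diff_of_diffs_le[of "y j" 0 R "y j'" 0]
        abs_diff_of_diffs_le[of "x j" "y j" d "x j'" "y j'"] xR yR xyd that by simp_all
    let ?h = "\<lambda>z. hamiltonian c (z (1 - i, n) - z (i, n)) (real n / real N) i"
    let ?u = "\<lambda>z. real (N - n) * b t z (1, n + 1 - i) * (z (i, n + 1) - z (i, n))"
    let ?v = "\<lambda>z. real n * b t z (0, n - i) * (z (i, n - 1) - z (i, n))"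
    have "\<bar>?u x - ?u y\<bar> \<le> N * (L * (2 * R) + L * 2) * d"
    proof (rule weighted_product_lipschitz)
      assume "real (N - n) \<noteq> 0"
      then have "n < N" by simp
      show "\<bar>b t x (1, n + 1 - i) - b t y (1, n + 1 - i)\<bar> \<le> L * d \<and>
        \<bar>b t y (1, n + 1 - i)\<bar> \<le> L \<and> \<bar>x (i, n + 1) - x (i, n)\<bar> \<le> 2 * R \<and>
        \<bar>x (i, n + 1) - x (i, n) - (y (i, n + 1) - y (i, n))\<bar> \<le> 2 * d"
        using L(2)[OF t xy 1(8)[OF \<open>n < N\<close>]] diff[OF 1(7)[OF \<open>n < N\<close>] 1(5)] by blast
    qed (use d R L(1) in auto)
    moreover have "\<bar>?v x - ?v y\<bar> \<le> N * (L * (2 * R) + L * 2) * d"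
    proof (rule weighted_product_lipschitz)
      assume "real n \<noteq> 0"
      then have "0 < n" by simp
      show "\<bar>b t x (0, n - i) - b t y (0, n - i)\<bar> \<le> L * d \<and>
        \<bar>b t y (0, n - i)\<bar> \<le> L \<and> \<bar>x (i, n - 1) - x (i, n)\<bar> \<le> 2 * R \<and>
        \<bar>x (i, n - 1) - x (i, n) - (y (i, n - 1) - y (i, n))\<bar> \<le> 2 * d"
        using L(2)[OF t xy 1(10)[OF \<open>0 < n\<close>]] diff[OF 1(9)[OF \<open>0 < n\<close>] 1(5)] by blast
    qed (use d R L(1) 1(3) in auto)
    moreover have "\<bar>?h x - ?h y\<bar> \<le> (A + M * (2 * R)) * 2 * d"
    proof -
      have a: "opt_rate c p (real n / real N) i \<le> A + M * (2 * R)" if "\<bar>p\<bar> \<le> 2 * R" for p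
        using AM[OF 1(5), of p] mult_left_mono[OF that M] by linarith
      have "\<bar>?h x - ?h y\<bar> \<le> (A + M * (2 * R)) * (2 * d)"
      proof (rule order_trans[OF hamiltonian_diff_le[OF 1(2,4)] mult_mono])
        show "max (opt_rate c (x (1 - i, n) - x (i, n)) (real n / real N) i)
          (opt_rate c (y (1 - i, n) - y (i, n)) (real n / real N) i) \<le> A + M * (2 * R)"
          by (intro max.boundedI a diff 1(5,6))
        show "0 \<le> A + M * (2 * R)" using A M R by simp
      qed (rule diff[OF 1(6,5)] abs_ge_zero)+
      then show ?thesis unfolding mult.assoc .
    qed
    ultimately have "\<bar>?u x + ?v x + ?h x - (?u y + ?v y + ?h y)\<bar> \<le> C * d"
      unfolding C_def distrib_right by (rule abs_diff_of_sums_le)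
    then show ?thesis unfolding 1(1) hjb.simps .
  qed
  then show ?thesis by blast
qed

lemma hjb_exists:
  assumes "0 \<le> T"
    and nonneg: "\<And>t z k. t \<in> {0..T} \<Longrightarrow> k \<in> states N \<Longrightarrow> 0 \<le> b t z k"
    and cont: "\<And>x k. \<forall>j\<in>states N. continuous_on {0..T} (x j) \<Longrightarrow> k \<in> states N \<Longrightarrow>
      continuous_on {0..T} (\<lambda>t. b t (\<lambda>j. x j t) k)"
    and lip: "\<And>R. \<exists>L\<ge>0. \<forall>t\<in>{0..T}. \<forall>x y d. (\<forall>j\<in>states N. \<bar>x j\<bar> \<le> R \<and> \<bar>y j\<bar> \<le> R \<and> \<bar>x j - y j\<bar> \<le> d) \<longrightarrow>
      (\<forall>k\<in>states N. \<bar>b t y k\<bar> \<le> L \<and> \<bar>b t x k - b t y k\<bar> \<le> L * d)"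
  shows "\<exists>x. solves_tvp T (states N) (hjb c N b) p x"
proof -
  \<comment> \<open>Running costs at rate 0 bound the field at maximal components; their sum is one
    constant for all states.\<close>
  define a where "a k = c (fst k) (real (snd k) / real N) 0" for k
  have a: "0 \<le> a k" if "k \<in> states N" for k
    using c_nonneg statesD[OF that] unfolding a_def by blast
  have K: "a k \<le> sum a (states N)" if "k \<in> states N" for k
    using that a finite_states by (intro member_le_sum) auto
  have K0: "0 \<le> sum a (states N)" using a by (rule sum_nonneg)
  show ?thesis
  proof (rule tvp_exists[OF finite_states assms(1) _ _ _ _ K0])
    show "continuous_on {0..T} (\<lambda>t. hjb c N b t (\<lambda>j. x j t) k)"
      if "\<forall>j\<in>states N. continuous_on {0..T} (x j)" "k \<in> states N" for x k
      using cont[of x] that by (intro hjb_continuous) auto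
    show "\<exists>L. \<forall>t\<in>{0..T}. \<forall>x y d. (\<forall>j\<in>states N. \<bar>x j\<bar> \<le> R \<and> \<bar>y j\<bar> \<le> R \<and> \<bar>x j - y j\<bar> \<le> d) \<longrightarrow>
      (\<forall>k\<in>states N. \<bar>hjb c N b t x k - hjb c N b t y k\<bar> \<le> L * d)" for R
      by (rule hjb_locally_lipschitz[OF lip])
    show "hjb c N b t z s \<le> sum a (states N)"
      if "t \<in> {0..T}" "s \<in> states N" "\<And>j. j \<in> states N \<Longrightarrow> z j \<le> z s" for t s z
    proof -
      have "hjb c N b t z s \<le> a s"
        unfolding a_def by (rule hjb_le_at_max[where b = b and t = t and z = z, OF nonneg[OF that(1)] that(2,3)])
      with K[OF that(2)] show ?thesis by linarith
    qed
    show "- sum a (states N) \<le> hjb c N b t z s"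
      if "t \<in> {0..T}" "s \<in> states N" "\<And>j. j \<in> states N \<Longrightarrow> z s \<le> z j" for t s z
    proof -
      have "0 \<le> hjb c N b t z s" by (rule hjb_nonneg_at_min[where b = b and t = t and z = z, OF nonneg[OF that(1)] that(2,3)])
      with K0 show ?thesis by linarith
    qed
  qed
qed

section \<open>The closed loop\<close>

lemma feedback_locally_lipschitz:
  "\<exists>L\<ge>0. \<forall>t\<in>A. \<forall>x y d. (\<forall>j\<in>states N. \<bar>x j\<bar> \<le> R \<and> \<bar>y j\<bar> \<le> R \<and> \<bar>x j - y j\<bar> \<le> d) \<longrightarrow>
      (\<forall>k\<in>states N. \<bar>feedback c N y k\<bar> \<le> L \<and> \<bar>feedback c N x k - feedback c N y k\<bar> \<le> L * d)"
proof -
  obtain B M where B: "B \<ge> 0" and M: "M \<ge> 0" and AM: "\<And>i n p q. (i, n) \<in> states N \<Longrightarrow>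
     opt_rate c p (real n / real N) i \<le> B + M * \<bar>p\<bar> \<and>
     \<bar>opt_rate c p (real n / real N) i - opt_rate c q (real n / real N) i\<bar> \<le> M * \<bar>p - q\<bar>"
    using opt_rate_affine_bound[of N] by blast
  \<comment> \<open>The first two summands bound the rate, the last its Lipschitz constant. The
    absolute value keeps \<open>L\<close> nonnegative for negative \<open>R\<close>, where the
    condition on \<open>x\<close> and \<open>y\<close> cannot hold.\<close>
  define L where "L = B + M * (2 * \<bar>R\<bar>) + 2 * M"
  have "\<bar>feedback c N y k\<bar> \<le> L \<and> \<bar>feedback c N x k - feedback c N y k\<bar> \<le> L * d"
    if xy: "\<forall>j\<in>states N. \<bar>x j\<bar> \<le> R \<and> \<bar>y j\<bar> \<le> R \<and> \<bar>x j - y j\<bar> \<le> d" and k: "k \<in> states N" for x y d k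
    using k
  proof (cases rule: states_cases)
    case (1 i n)
    define p q where "p = x (1 - i, n) - x (i, n)" and "q = y (1 - i, n) - y (i, n)"
    have y: "\<bar>y (i, n)\<bar> \<le> R" "\<bar>y (1 - i, n)\<bar> \<le> R"
      and xyd: "\<bar>x (i, n) - y (i, n)\<bar> \<le> d" "\<bar>x (1 - i, n) - y (1 - i, n)\<bar> \<le> d"
      using xy 1(5,6) by blast+
    have "\<bar>q\<bar> \<le> 2 * R" unfolding q_def
      using abs_diff_of_diffs_le[of "y (1 - i, n)" 0 R "y (i, n)" 0] y by simp
    then have q: "\<bar>q\<bar> \<le> 2 * \<bar>R\<bar>" by linarith
    have pq: "\<bar>p - q\<bar> \<le> 2 * d"
      unfolding p_def q_def by (intro abs_diff_of_diffs_le xyd)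
    have d: "0 \<le> d" by (rule order_trans[OF abs_ge_zero xyd(1)])
    have eq: "feedback c N y k = opt_rate c q (real n / real N) i"
      "feedback c N x k = opt_rate c p (real n / real N) i" by (simp_all add: 1(1) p_def q_def)
    have "\<bar>feedback c N y k\<bar> \<le> B + M * \<bar>q\<bar>"
      using AM[OF 1(5), of q] opt_rate_nonneg[OF 1(2,4), of q] unfolding eq by auto
    also have "\<dots> \<le> L" using mult_left_mono[OF q M] M by (simp add: L_def)
    finally have "\<bar>feedback c N y k\<bar> \<le> L" .
    moreover have "\<bar>feedback c N x k - feedback c N y k\<bar> \<le> M * \<bar>p - q\<bar>"
      using AM[OF 1(5), of p q] unfolding eq by blast
    moreover have "M * \<bar>p - q\<bar> \<le> L * d"
    proof -
      have "M * \<bar>p - q\<bar> \<le> 2 * M * d" using mult_left_mono[OF pq M] by simp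
      also have "\<dots> \<le> L * d" using B M d by (intro mult_right_mono) (auto simp: L_def)
      finally show ?thesis .
    qed
    ultimately show ?thesis by simp
  qed
  moreover have "0 \<le> L" using B M by (simp add: L_def)
  ultimately show ?thesis
    by (intro exI[of _ L] conjI ballI allI impI) blast+
qed

lemma feedback_continuous:
  assumes x: "\<forall>j\<in>states N. continuous_on {0..T} (x j)" and k: "k \<in> states N"
  shows "continuous_on {0..T} (\<lambda>t. feedback c N (\<lambda>j. x j t) k)"
  using k
proof (cases rule: states_cases)
  case (1 i n)
  then show ?thesis using x unfolding 1(1) feedback.simps
    by (intro continuous_on_compose2[OF continuous_on_opt_rate[OF 1(2,4)]] continuous_intros) auto
qed

lemma feedback_nonneg: "k \<in> states N \<Longrightarrow> 0 \<le> feedback c N z k"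
  using opt_rate_nonneg[OF statesD] by (metis feedback.elims fst_conv snd_conv)

lemma closed_loop_locally_lipschitz:
  "\<exists>L. \<forall>t\<in>{0..T}. \<forall>x y d. (\<forall>j\<in>states N. \<bar>x j\<bar> \<le> R \<and> \<bar>y j\<bar> \<le> R \<and> \<bar>x j - y j\<bar> \<le> d) \<longrightarrow>
    (\<forall>k\<in>states N. \<bar>hjb c N (\<lambda>t. feedback c N) t x k - hjb c N (\<lambda>t. feedback c N) t y k\<bar> \<le> L * d)"
  by (rule hjb_locally_lipschitz[where b = "\<lambda>t. feedback c N"]) (rule feedback_locally_lipschitz)

lemma closed_loop_exists:
  assumes "0 \<le> T"
  shows "\<exists>x. solves_tvp T (states N) (hjb c N (\<lambda>t. feedback c N)) p x"
proof (rule hjb_exists[OF assms])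
  show "0 \<le> feedback c N z k" if "k \<in> states N" for z k
    using that by (rule feedback_nonneg)
  show "continuous_on {0..T} (\<lambda>t. feedback c N (\<lambda>j. x j t) k)"
    if "\<forall>j\<in>states N. continuous_on {0..T} (x j)" "k \<in> states N" for x k
    using that by (rule feedback_continuous)
qed (rule feedback_locally_lipschitz)

lemma closed_loop_unique:
  assumes "0 \<le> T" "solves_tvp T (states N) (hjb c N (\<lambda>t. feedback c N)) p x"
    "solves_tvp T (states N) (hjb c N (\<lambda>t. feedback c N)) p y" "k \<in> states N" "t \<in> {0..T}"
  shows "x k t = y k t"
  using finite_states assms(1) closed_loop_locally_lipschitz assms(2-5) by (rule tvp_unique)

end

section \<open>Nash equilibria\<close>

text \<open>The two fields need to agree only along the given solution. This is the passage between
  open and closed loop, whose fields differ at other arguments.\<close>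

lemma solves_tvp_cong:
  assumes x: "solves_tvp T S F p x" and "0 \<le> T"
    and y: "\<And>k t. k \<in> S \<Longrightarrow> t \<in> {0..T} \<Longrightarrow> x k t = y k t"
    and F: "\<And>k t. k \<in> S \<Longrightarrow> t \<in> {0..T} \<Longrightarrow> F t (\<lambda>j. x j t) k = F' t (\<lambda>j. y j t) k"
  shows "solves_tvp T S F' p y"
  unfolding solves_tvp_def
proof (intro ballI conjI)
  fix k assume k: "k \<in> S"
  show "y k T = p k" using solves_tvpD(1)[OF x k] y[OF k, of T] \<open>0 \<le> T\<close> by simp
  fix t assume t: "t \<in> {0..T}"
  show "(y k has_real_derivative - F' t (\<lambda>j. y j t) k) (at t within {0..T})"
    unfolding F[OF k t, symmetric]
    by (rule has_field_derivative_transform_within[OF solves_tvpD(2)[OF x k t] zero_less_one t])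
       (rule y[OF k])
qed

lemma hjb_cong:
  assumes z: "\<And>j. j \<in> states N \<Longrightarrow> z j = z' j"
    and b: "\<And>j. j \<in> states N \<Longrightarrow> b t z j = b' t z' j" and k: "k \<in> states N"
  shows "hjb c N b t z k = hjb c N b' t z' k"
  using k
proof (cases rule: states_cases)
  case (1 i n)
  have "real (N - n) * b t z (1, n + 1 - i) * (z (i, n + 1) - z' (i, n)) =
      real (N - n) * b' t z' (1, n + 1 - i) * (z' (i, n + 1) - z' (i, n))"
  proof (cases "n < N")
    case True
    show ?thesis unfolding z[OF 1(7)[OF True]] b[OF 1(8)[OF True]] ..
  qed simp
  moreover have "real n * b t z (0, n - i) * (z (i, n - 1) - z' (i, n)) =
      real n * b' t z' (0, n - i) * (z' (i, n - 1) - z' (i, n))"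
  proof (cases "0 < n")
    case True
    show ?thesis unfolding z[OF 1(9)[OF True]] b[OF 1(10)[OF True]] ..
  qed simp
  ultimately show ?thesis unfolding 1(1) hjb.simps z[OF 1(5)] z[OF 1(6)] by (simp only:)
qed

lemma feedback_cong:
  assumes z: "\<And>j. j \<in> states N \<Longrightarrow> z j = z' j" and k: "k \<in> states N"
  shows "feedback c N z k = feedback c N z' k"
  using k
proof (cases rule: states_cases)
  case (1 i n)
  then show ?thesis by (simp only: feedback.simps z)
qed

text \<open>A fixed control becomes a rate that ignores the unknown, so the value equation is the
  open-loop instance of \<open>hjb\<close>.\<close>

lemma is_value_function_iff:
  "is_value_function c \<psi> N T \<beta> \<phi> \<longleftrightarrow> \<phi> \<in> extensional (state_time N T) \<and>
    solves_tvp T (states N) (hjb c N (\<lambda>t z k. \<beta> (fst k, snd k, t)))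
      (\<lambda>k. \<psi> (fst k) (real (snd k) / real N)) (\<lambda>k t. \<phi> (fst k, snd k, t))"
  unfolding is_value_function_def solves_tvp_def states_def gamma_plus_def gamma_minus_def
  by auto

lemma best_response_eq:
  "best_response c \<psi> N T \<beta> = restrict (\<lambda>(i, n, t).
    feedback c N (\<lambda>k. value_function c \<psi> N T \<beta> (fst k, snd k, t)) (i, n)) (state_time N T)"
  unfolding best_response_def Let_def by (intro arg_cong2[where f = restrict]) (auto simp: fun_eq_iff)

lemma state_time_iff: "(i, n, t) \<in> state_time N T \<longleftrightarrow> (i, n) \<in> states N \<and> t \<in> {0..T}"
  by (auto simp: state_time_def states_def)

section \<open>Value functions and their fixed points\<close>

context cost_assumptions
begin

lemma open_loop_rates:
  assumes "admissible N T \<beta>"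
  shows "t \<in> {0..T} \<Longrightarrow> k \<in> states N \<Longrightarrow> 0 \<le> \<beta> (fst k, snd k, t)"
    and "k \<in> states N \<Longrightarrow> continuous_on {0..T} (\<lambda>t. \<beta> (fst k, snd k, t))"
    and "\<exists>L\<ge>0. \<forall>t\<in>{0..T}. \<forall>x y d. (\<forall>j\<in>states N. \<bar>x j\<bar> \<le> R \<and> \<bar>y j\<bar> \<le> R \<and> \<bar>x j - y j\<bar> \<le> d) \<longrightarrow>
      (\<forall>k\<in>states N. \<bar>\<beta> (fst k, snd k, t)\<bar> \<le> L \<and> \<bar>\<beta> (fst k, snd k, t) - \<beta> (fst k, snd k, t)\<bar> \<le> L * d)"
proof -
  show "0 \<le> \<beta> (fst k, snd k, t)" if "t \<in> {0..T}" "k \<in> states N" for k t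
  proof -
    have "(fst k, snd k, t) \<in> state_time N T" using that by (simp add: state_time_iff)
    then show ?thesis using assms unfolding admissible_def by (meson PiE_mem atLeast_iff)
  qed
  show "continuous_on {0..T} (\<lambda>t. \<beta> (fst k, snd k, t))" if "k \<in> states N"
    using assms that by (auto simp: admissible_def states_def)
  obtain L where L: "\<And>z. z \<in> state_time N T \<Longrightarrow> \<bar>\<beta> z\<bar> \<le> L"
    using assms unfolding admissible_def bounded_iff by auto
  have "\<bar>\<beta> (fst k, snd k, t)\<bar> \<le> \<bar>L\<bar>" if "t \<in> {0..T}" "k \<in> states N" for k t
    using L[of "(fst k, snd k, t)"] that by (simp add: state_time_iff)
  \<comment> \<open>The rate does not vary with the unknown, so its Lipschitz bound reduces to
    \<open>d\<close> being nonnegative, which holds since \<open>d\<close> dominates an absolute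
    value.\<close>
  moreover have "0 \<le> \<bar>L\<bar> * d" if "\<forall>j\<in>states N. \<bar>x j\<bar> \<le> R \<and> \<bar>y j\<bar> \<le> R \<and> \<bar>x j - y j\<bar> \<le> d"
    "k \<in> states N" for x y :: "nat \<times> nat \<Rightarrow> real" and d k
    using that by (intro mult_nonneg_nonneg) (auto intro: order_trans[OF abs_ge_zero])
  ultimately show "\<exists>L\<ge>0. \<forall>t\<in>{0..T}. \<forall>x y d.
      (\<forall>j\<in>states N. \<bar>x j\<bar> \<le> R \<and> \<bar>y j\<bar> \<le> R \<and> \<bar>x j - y j\<bar> \<le> d) \<longrightarrow>
      (\<forall>k\<in>states N. \<bar>\<beta> (fst k, snd k, t)\<bar> \<le> L \<and> \<bar>\<beta> (fst k, snd k, t) - \<beta> (fst k, snd k, t)\<bar> \<le> L * d)"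
    unfolding diff_self abs_zero
    by (intro exI[of _ "\<bar>L\<bar>"] conjI ballI allI impI abs_ge_zero) assumption+
qed

lemma value_function_exists:
  assumes "0 \<le> T" and \<beta>: "admissible N T \<beta>"
  shows "\<exists>\<phi>. is_value_function c \<psi> N T \<beta> \<phi>"
proof -
  let ?p = "\<lambda>k. \<psi> (fst k) (real (snd k) / real N)"
  obtain x where x: "solves_tvp T (states N) (hjb c N (\<lambda>t z k. \<beta> (fst k, snd k, t))) ?p x"
    using hjb_exists[where b = "\<lambda>t z k. \<beta> (fst k, snd k, t)" and p = ?p, OF assms(1)
        open_loop_rates(1)[OF \<beta>] open_loop_rates(2)[OF \<beta>] open_loop_rates(3)[OF \<beta>]] ..
  define \<phi> where "\<phi> = restrict (\<lambda>(i, n, t). x (i, n) t) (state_time N T)"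
  have \<phi>: "x k t = \<phi> (fst k, snd k, t)" if "k \<in> states N" "t \<in> {0..T}" for k t
    using that by (simp add: \<phi>_def state_time_iff)
  have "solves_tvp T (states N) (hjb c N (\<lambda>t z k. \<beta> (fst k, snd k, t)))
      (\<lambda>k. \<psi> (fst k) (real (snd k) / real N)) (\<lambda>k t. \<phi> (fst k, snd k, t))"
    by (rule solves_tvp_cong[OF x assms(1)]; (rule hjb_cong)?) (simp_all only: \<phi>)
  then have "is_value_function c \<psi> N T \<beta> \<phi>"
    unfolding is_value_function_iff by (simp add: \<phi>_def)
  then show ?thesis by blast
qed

lemma extensional_state_time_eqI:
  assumes "\<phi>1 \<in> extensional (state_time N T)" "\<phi>2 \<in> extensional (state_time N T)"
    and "\<And>k t. k \<in> states N \<Longrightarrow> t \<in> {0..T} \<Longrightarrow> \<phi>1 (fst k, snd k, t) = \<phi>2 (fst k, snd k, t)"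
  shows "\<phi>1 = \<phi>2"
proof (rule extensionalityI[OF assms(1,2)])
  fix z assume "z \<in> state_time N T"
  then show "\<phi>1 z = \<phi>2 z" using assms(3) by (cases z) (force simp: state_time_iff)
qed

lemma value_function_unique:
  assumes "0 \<le> T" and \<beta>: "admissible N T \<beta>"
    and 1: "is_value_function c \<psi> N T \<beta> \<phi>1" and 2: "is_value_function c \<psi> N T \<beta> \<phi>2"
  shows "\<phi>1 = \<phi>2"
proof (rule extensional_state_time_eqI)
  fix k t assume kt: "k \<in> states N" "t \<in> {0..T}"
  show "\<phi>1 (fst k, snd k, t) = \<phi>2 (fst k, snd k, t)"
  proof (rule tvp_unique[OF finite_states assms(1), where x = "\<lambda>k t. \<phi>1 (fst k, snd k, t)"
        and y = "\<lambda>k t. \<phi>2 (fst k, snd k, t)"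
        and p = "\<lambda>k. \<psi> (fst k) (real (snd k) / real N)"])
    show "\<exists>L. \<forall>t\<in>{0..T}. \<forall>x y d. (\<forall>j\<in>states N. \<bar>x j\<bar> \<le> R \<and> \<bar>y j\<bar> \<le> R \<and> \<bar>x j - y j\<bar> \<le> d) \<longrightarrow>
      (\<forall>k\<in>states N. \<bar>hjb c N (\<lambda>t z k. \<beta> (fst k, snd k, t)) t x k -
        hjb c N (\<lambda>t z k. \<beta> (fst k, snd k, t)) t y k\<bar> \<le> L * d)" for R
      by (rule hjb_locally_lipschitz[OF open_loop_rates(3)[OF \<beta>]])
  qed (use 1 2 kt in \<open>simp_all only: is_value_function_iff\<close>)
qed (use 1 2 in \<open>auto simp: is_value_function_iff\<close>)

lemma value_function_eq:
  assumes "0 \<le> T" "admissible N T \<beta>" "is_value_function c \<psi> N T \<beta> \<phi>"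
  shows "value_function c \<psi> N T \<beta> = \<phi>"
  unfolding value_function_def
  using assms by (intro the_equality value_function_unique)

text \<open>Take the feedback along a closed-loop solution as a control. Along that solution the
  open-loop field of this control coincides with the closed-loop field, so the solution is the value
  function of the control, and the best response returns the same feedback.\<close>

lemma nash_equilibrium_exists:
  assumes "0 \<le> T"
  shows "\<exists>\<beta>. nash_equilibrium c \<psi> N T \<beta>"
proof -
  obtain x where x: "solves_tvp T (states N) (hjb c N (\<lambda>t. feedback c N))
      (\<lambda>k. \<psi> (fst k) (real (snd k) / real N)) x"
    using closed_loop_exists[OF assms] by blast
  have x_cont: "\<forall>j\<in>states N. continuous_on {0..T} (x j)"
    using solves_tvp_continuous_on[OF x] by blast
  define \<phi> where "\<phi> = restrict (\<lambda>(i, n, t). x (i, n) t) (state_time N T)"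
  define \<beta> where "\<beta> = restrict (\<lambda>(i, n, t). feedback c N (\<lambda>j. x j t) (i, n)) (state_time N T)"
  have \<phi>: "x k t = \<phi> (fst k, snd k, t)"
    and \<beta>: "feedback c N (\<lambda>j. x j t) k = \<beta> (fst k, snd k, t)" if "k \<in> states N" "t \<in> {0..T}" for k t
    using that by (simp_all add: \<phi>_def \<beta>_def state_time_iff del: feedback.simps)
  have cont: "continuous_on {0..T} (\<lambda>t. \<beta> (fst k, snd k, t))" if k: "k \<in> states N" for k
    using feedback_continuous[OF x_cont k] by (rule continuous_on_eq) (rule \<beta>[OF k])
  have adm: "admissible N T \<beta>"
    unfolding admissible_def
  proof (intro conjI ballI)
    show "\<beta> \<in> state_time N T \<rightarrow>\<^sub>E {0..}"
      unfolding \<beta>_def using feedback_nonneg by (intro restrict_PiE_iff[THEN iffD2]) (auto simp: state_time_iff)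
    obtain R where "\<forall>k\<in>states N. \<forall>t\<in>{0..T}. \<bar>\<beta> (fst k, snd k, t)\<bar> \<le> R"
      using bounded_family_on_interval[of "states N" T "\<lambda>k t. \<beta> (fst k, snd k, t)", OF finite_states cont]
      by blast
    then show "bounded (\<beta> ` state_time N T)"
      unfolding bounded_iff by (intro exI[of _ R]) (force simp: state_time_iff)
    show "continuous_on {0..T} (\<lambda>t. \<beta> (i, n, t))" if "i \<in> {0, 1}" "n \<in> {0..N}" for i n
      using cont[of "(i, n)"] that by (simp add: states_def)
  qed
  have "solves_tvp T (states N) (hjb c N (\<lambda>t z k. \<beta> (fst k, snd k, t)))
      (\<lambda>k. \<psi> (fst k) (real (snd k) / real N)) (\<lambda>k t. \<phi> (fst k, snd k, t))"
    by (rule solves_tvp_cong[OF x assms]; (rule hjb_cong)?) (simp_all only: \<phi> flip: \<beta>)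
  then have "is_value_function c \<psi> N T \<beta> \<phi>"
    unfolding is_value_function_iff by (simp add: \<phi>_def)
  then have vf: "value_function c \<psi> N T \<beta> = \<phi>"
    by (rule value_function_eq[OF assms adm])
  have "best_response c \<psi> N T \<beta> = \<beta>"
    unfolding best_response_eq vf
  proof (rule extensional_state_time_eqI)
    fix k t assume kt: "k \<in> states N" "t \<in> {0..T}"
    have "feedback c N (\<lambda>k. \<phi> (fst k, snd k, t)) k = feedback c N (\<lambda>j. x j t) k"
      using kt by (intro feedback_cong) (simp_all only: \<phi>)
    then show "restrict (\<lambda>(i, n, t). feedback c N (\<lambda>k. \<phi> (fst k, snd k, t)) (i, n)) (state_time N T)
        (fst k, snd k, t) = \<beta> (fst k, snd k, t)"
      using kt \<beta>[OF kt] by (simp add: state_time_iff del: feedback.simps)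
  qed (simp_all add: \<beta>_def)
  with adm show ?thesis unfolding nash_equilibrium_def by blast
qed

text \<open>The fixed point equation says that the control is the feedback of its own value
  function; substituting this into the value equation closes the loop.\<close>

lemma nash_equilibrium_closed_loop:
  assumes "0 \<le> T" and nash: "nash_equilibrium c \<psi> N T \<beta>"
  shows "value_function c \<psi> N T \<beta> \<in> extensional (state_time N T)"
    and "solves_tvp T (states N) (hjb c N (\<lambda>t. feedback c N))
      (\<lambda>k. \<psi> (fst k) (real (snd k) / real N)) (\<lambda>k t. value_function c \<psi> N T \<beta> (fst k, snd k, t))"
proof -
  have adm: "admissible N T \<beta>" and br: "best_response c \<psi> N T \<beta> = \<beta>"
    using nash by (auto simp: nash_equilibrium_def)
  have vf: "is_value_function c \<psi> N T \<beta> (value_function c \<psi> N T \<beta>)"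
    using value_function_exists[OF assms(1) adm] value_function_eq[OF assms(1) adm] by metis
  then show "value_function c \<psi> N T \<beta> \<in> extensional (state_time N T)"
    by (simp add: is_value_function_iff)
  have \<beta>: "\<beta> (fst k, snd k, t) = feedback c N (\<lambda>k. value_function c \<psi> N T \<beta> (fst k, snd k, t)) k"
    if "k \<in> states N" "t \<in> {0..T}" for k t
  proof -
    have "\<beta> (fst k, snd k, t) = best_response c \<psi> N T \<beta> (fst k, snd k, t)" by (simp only: br)
    then show ?thesis
      using that by (simp add: best_response_eq state_time_iff del: feedback.simps)
  qed
  show "solves_tvp T (states N) (hjb c N (\<lambda>t. feedback c N))
      (\<lambda>k. \<psi> (fst k) (real (snd k) / real N)) (\<lambda>k t. value_function c \<psi> N T \<beta> (fst k, snd k, t))"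
    using vf[unfolded is_value_function_iff, THEN conjunct2] assms(1)
    by (rule solves_tvp_cong) (rule refl, rule hjb_cong, simp_all only: \<beta>)
qed

text \<open>The best response sees a control only through its value function. Equal value functions
  therefore give equal best responses, which are the equilibria themselves.\<close>

lemma nash_equilibrium_unique:
  assumes "0 \<le> T" and 1: "nash_equilibrium c \<psi> N T \<beta>1" and 2: "nash_equilibrium c \<psi> N T \<beta>2"
  shows "\<beta>1 = \<beta>2"
proof -
  have "value_function c \<psi> N T \<beta>1 = value_function c \<psi> N T \<beta>2"
    using nash_equilibrium_closed_loop[OF assms(1) 1] nash_equilibrium_closed_loop[OF assms(1) 2]
    by (intro extensional_state_time_eqI[of _ N T])
      (assumption | rule closed_loop_unique[OF assms(1),
        where x = "\<lambda>k t. value_function c \<psi> N T \<beta>1 (fst k, snd k, t)"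
          and y = "\<lambda>k t. value_function c \<psi> N T \<beta>2 (fst k, snd k, t)"])+
  then have "best_response c \<psi> N T \<beta>1 = best_response c \<psi> N T \<beta>2"
    by (simp add: best_response_def)
  with 1 2 show ?thesis by (simp add: nash_equilibrium_def)
qed

end

theorem theorem2:
  fixes c c' :: "nat \<Rightarrow> real \<Rightarrow> real \<Rightarrow> real" and \<psi> :: "nat \<Rightarrow> real \<Rightarrow> real"
    and N :: nat and T :: real
  assumes "N \<ge> 1" and "T > 0" and "cost_assumptions c c' \<psi>"
  shows "\<exists>!\<beta>. nash_equilibrium c \<psi> N T \<beta>"
proof -
  interpret cost_assumptions c c' \<psi> by fact
  from \<open>T > 0\<close> have "0 \<le> T" by simp
  then show ?thesis
    using nash_equilibrium_exists nash_equilibrium_unique by blast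
qed

end
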